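(* Let $[k_0,k_1,k_\infty]$ be one of the polyhedral triples D1–D3, T1–T3, O1–O6, I1–I6 listed in the context and let $N$ be the corresponding group order. Then there are homogeneous polynomials $P_0,P_1,P_\infty\in\mathbb{C}[X,Y]$, depending only on the ordered triple $[k_0,k_1,k_\infty]$, with $\deg P_j=N/k_j$ for $j=0,1,\infty$, and given by the explicit formulas in the context for the triples D1, D2, D3, T1, T2, T3, O1, O2, O3, O4, O5, O6, I1, I6, such that the following holds. Let $(a,b,c)$ be any real triple such that $\mu_0=1-c$, $\mu_1=c-a-b$, $\mu_\infty=a-b$ satisfy $|\mu_0|=1/k_0$, $|\mu_1|=1/k_1$, $|\mu_\infty|=1/k_\infty$. Exchanging $a$ and $b$ if necessary (this only changes the sign of $\mu_\infty$), exactly one of the sign patterns (i)–(iv) below holds. Let $$u(x)=F(a,b,c;x),\qquad v(x)=x^{1-c}F(a-c+1,b-c+1,2-c;x)$$ be the two Kummer solutions near $x=0$ of the hypergeometric equation $x(1-x)w''+\{c-(a+b+1)x\}w'-abw=0$. Put $(U,V)=(u,v)$ in cases (i), (ii) and $(U,V)=(v,u)$ in cases (iii), (iv). Then $$P_j(U(x),V(x))=f_j(x),\qquad j=0,1,\infty,$$ where (i) if $\mu_0>0,\ \mu_1>0,\ \mu_\infty>0$: $\quad f_0=x^{1/k_0},\quad f_1=(1-x)^{1/k_1},\quad f_\infty=1$; (ii) if $\mu_0>0,\ \mu_1<0,\ \mu_\infty<0$: $\quad f_0=x^{1/k_0}(1-x)^{-N/(k_0k_1)},\quad f_1=(1-x)^{1/k_1-N/k_1^2},\quad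 f_\infty=(1-x)^{-N/(k_1k_\infty)}$; (iii) if $\mu_0<0,\ \mu_1>0,\ \mu_\infty<0$: $\quad f_0=x^{1/k_0-N/k_0^2},\quad f_1=x^{-N/(k_0k_1)}(1-x)^{1/k_1},\quad f_\infty=x^{-N/(k_0k_\infty)}$; (iv) if $\mu_0<0,\ \mu_1<0,\ \mu_\infty>0$: $\quad f_0=x^{1/k_0-N/k_0^2}(1-x)^{-N/(k_0k_1)},\quad f_1=x^{-N/(k_0k_1)}(1-x)^{1/k_1-N/k_1^2},\quad f_\infty=x^{-N/(k_0k_\infty)}(1-x)^{-N/(k_1k_\infty)}$.
   Context: $F(a,b,c;x)=\sum_{n\ge0}\frac{(a,n)(b,n)}{(c,n)(1,n)}x^n$, where $(a,n)=a(a+1)\cdots(a+n-1)$ (with $(a,0)=1$). The identities are understood near $x=0$ (and then by analytic continuation), with one fixed branch of $\log x$ used for all powers of $x$ (in $v$ and in the $f_j$), and with $(1-x)^{\ast}$ equal to $1$ at $x=0$. Polyhedral triples $[k_0,k_1,k_\infty]$ and group order $N$, where $\frac2N=\frac1{k_0}+\frac1{k_1}+\frac1{k_\infty}-1$: Dihedral ($n\ge2$, $N=2n$): D1 $=[2,2,n]$, D2 $=[2,n,2]$, D3 $=[n,2,2]$. Tetrahedral ($N=12$): T1 $=[2,3,3]$, T2 $=[3,2,3]$, T3 $=[3,3,2]$. Octahedral ($N=24$): O1 $=[2,3,4]$, O2 $=[2,4,3]$, O3 $=[3,2,4]$, O4 $=[3,4,2]$, O5 $=[4,2,3]$, O6 $=[4,3,2]$.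 Icosahedral ($N=60$): I1 $=[2,3,5]$, I2 $=[2,5,3]$, I3 $=[3,2,5]$, I4 $=[3,5,2]$, I5 $=[5,2,3]$, I6 $=[5,3,2]$. Explicit polynomials (written in the variables $u,v$, i.e. $P_j=P_j(u,v)$; below $\sqrt{-1}$ is the imaginary unit and binomials $\binom{n}{m}$ with $m>n$ are $0$): D1: $P_0=\sqrt{-1}\sum_{k=0}^{[n/2]}\binom{n}{2k+1}u^{n-2k-1}\left(\frac{v}{\sqrt{-1}\,n}\right)^{2k+1}$, $P_1=\sum_{k=0}^{[n/2]}\binom{n}{2k}u^{n-2k}\left(\frac{v}{\sqrt{-1}\,n}\right)^{2k}$, $P_\infty=u^2+\frac1{n^2}v^2$. D2: $P_0=\sum_{k=0}^{[n/2]}\binom{n}{2k+1}u^{n-2k-1}\left(\frac vn\right)^{2k+1}$, $P_1=u^2-\frac1{n^2}v^2$, $P_\infty=\sum_{k=0}^{[n/2]}\binom{n}{2k}u^{n-2k}\left(\frac vn\right)^{2k}$. D3: $P_0=uv$, $P_1=u^n-\frac14v^n$, $P_\infty=u^n+\frac14v^n$. T1: $P_0=u^5v+\frac1{432}uv^5$, $P_1=u^4-\frac16u^2v^2-\frac1{432}v^4$, $P_\infty=u^4+\frac16u^2v^2-\frac1{432}v^4$. T2: $P_0=u^3v-\frac1{64}v^4$, $P_1=u^6-\frac5{16}u^3v^3-\frac1{512}v^6$, $P_\infty=u^4+\frac18uv^3$. T3: $P_0=u^3v+\frac1{64}v^4$, $P_1=u^4-\frac18uv^3$, $P_\infty=u^6+\frac5{16}u^3v^3-\frac1{512}v^6$.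 O1: $P_0=u^{11}v-\frac{11}{432}u^9v^3+\frac{11}{3456}u^7v^5+\frac{11}{165888}u^5v^7-\frac{11}{47775744}u^3v^9+\frac1{254803968}uv^{11}$, $P_1=u^8-\frac7{36}u^6v^2-\frac7{3456}u^4v^4-\frac7{82944}u^2v^6+\frac1{5308416}v^8$, $P_\infty=u^6+\frac5{48}u^4v^2-\frac5{2304}u^2v^4-\frac1{110592}v^6$. O2: $P_0=u^{11}v+\frac{11}{432}u^9v^3+\frac{11}{3456}u^7v^5-\frac{11}{165888}u^5v^7-\frac{11}{47775744}u^3v^9-\frac1{254803968}uv^{11}$, $P_1=u^6-\frac5{48}u^4v^2-\frac5{2304}u^2v^4+\frac1{110592}v^6$, $P_\infty=u^8+\frac7{36}u^6v^2-\frac7{3456}u^4v^4+\frac7{82944}u^2v^6+\frac1{5308416}v^8$. O3: $P_0=u^7v-\frac7{256}u^4v^4-\frac1{8192}uv^7$, $P_1=u^{12}-\frac{11}{32}u^9v^3-\frac{11}{262144}u^3v^9-\frac1{67108864}v^{12}$, $P_\infty=u^6+\frac5{64}u^3v^3-\frac1{8192}v^6$. O4: $P_0=u^7v+\frac7{256}u^4v^4-\frac1{8192}uv^7$, $P_1=u^6-\frac5{64}u^3v^3-\frac1{8192}v^6$, $P_\infty=u^{12}+\frac{11}{32}u^9v^3+\frac{11}{262144}u^3v^9-\frac1{67108864}v^{12}$. O5: $P_0=u^5v-\frac1{108}uv^5$, $P_1=u^{12}-\frac{11}{36}u^8v^4-\frac{11}{3888}u^4v^8+\frac1{1259712}v^{12}$,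 $P_\infty=u^8+\frac7{54}u^4v^4+\frac1{11664}v^8$. O6: $P_0=u^5v+\frac1{108}uv^5$, $P_1=u^8-\frac7{54}u^4v^4+\frac1{11664}v^8$, $P_\infty=u^{12}+\frac{11}{36}u^8v^4-\frac{11}{3888}u^4v^8-\frac1{1259712}v^{12}$. I1: $P_0=u^{29}v-\frac{29}{675}u^{27}v^3+\frac{1769}{450000}u^{25}v^5+\frac{29}{337500}u^{23}v^7+\frac{667}{540000000}u^{21}v^9-\frac{667}{72900000000}u^{19}v^{11}+\frac{12673}{29160000000000}u^{17}v^{13}-\frac{12673}{524880000000000000}u^{13}v^{17}+\frac{667}{23619600000000000000}u^{11}v^{19}-\frac{667}{3149280000000000000000}u^9v^{21}-\frac{29}{35429400000000000000000}u^7v^{23}-\frac{1769}{850305600000000000000000000}u^5v^{25}+\frac{29}{22958251200000000000000000000}u^3v^{27}-\frac1{612220032000000000000000000000}uv^{29}$, $P_1=u^{20}-\frac{19}{90}u^{18}v^2-\frac{19}{18000}u^{16}v^4-\frac{19}{135000}u^{14}v^6-\frac{247}{162000000}u^{12}v^8+\frac{247}{14580000000}u^{10}v^{10}-\frac{247}{2916000000000}u^8v^{12}-\frac{19}{43740000000000}u^6v^{14}-\frac{19}{104976000000000000}u^4v^{16}-\frac{19}{9447840000000000000}u^2v^{18}+\frac1{1889568000000000000000}v^{20}$, $P_\infty=u^{12}+\frac{11}{150}u^{10}v^2-\frac{11}{6000}u^8v^4-\frac{11}{1350000}u^6v^6-\frac{11}{108000000}u^4v^8+\frac{11}{48600000000}u^2v^{10}+\frac1{5832000000000}v^{12}$.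 I6: $P_0=u^{11}v+\frac{11}{1728}u^6v^6-\frac1{2985984}uv^{11}$, $P_1=u^{20}-\frac{19}{144}u^{15}v^5+\frac{247}{1492992}u^{10}v^{10}+\frac{19}{429981696}u^5v^{15}+\frac1{8916100448256}v^{20}$, $P_\infty=u^{30}+\frac{29}{96}u^{25}v^5-\frac{3335}{995328}u^{20}v^{10}-\frac{3335}{2972033482752}u^{10}v^{20}-\frac{29}{855945643032576}u^5v^{25}+\frac1{26623333280885243904}v^{30}$. *)

theory Defs
  imports "HOL-Complex_Analysis.Complex_Analysis"
begin

section \<open>Polyhedral triples\<close>

text \<open>\<open>polyhedral k0 k1 kinf N\<close>: the ordered triple occurs in the list and \<open>N\<close> is its group order.\<close>

inductive polyhedral :: "nat \<Rightarrow> nat \<Rightarrow> nat \<Rightarrow> nat \<Rightarrow> bool" where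
  D1: "n \<ge> 2 \<Longrightarrow> polyhedral 2 2 n (2 * n)"
| D2: "n \<ge> 2 \<Longrightarrow> polyhedral 2 n 2 (2 * n)"
| D3: "n \<ge> 2 \<Longrightarrow> polyhedral n 2 2 (2 * n)"
| T1: "polyhedral 2 3 3 12"
| T2: "polyhedral 3 2 3 12"
| T3: "polyhedral 3 3 2 12"
| O1: "polyhedral 2 3 4 24"
| O2: "polyhedral 2 4 3 24"
| O3: "polyhedral 3 2 4 24"
| O4: "polyhedral 3 4 2 24"
| O5: "polyhedral 4 2 3 24"
| O6: "polyhedral 4 3 2 24"
| I1: "polyhedral 2 3 5 60"
| I2: "polyhedral 2 5 3 60"
| I3: "polyhedral 3 2 5 60"
| I4: "polyhedral 3 5 2 60"
| I5: "polyhedral 5 2 3 60"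
| I6: "polyhedral 5 3 2 60"

lemma polyhedral_order:
  "polyhedral k0 k1 kinf N \<Longrightarrow> 2 / real N = 1 / real k0 + 1 / real k1 + 1 / real kinf - 1"
  by (induction rule: polyhedral.induct) (simp_all add: field_simps)

lemma polyhedral_dvd:
  "polyhedral k0 k1 kinf N \<Longrightarrow> k0 dvd N \<and> k1 dvd N \<and> kinf dvd N"
  by (induction rule: polyhedral.induct) simp_all


section \<open>Bivariate polynomials\<close>

text \<open>
  \<open>\<complex>[X,Y]\<close> is represented as \<open>\<complex>[X][Y]\<close>: the inner indeterminate is \<open>X\<close>, the outer one is \<open>Y\<close>,
  so \<open>coeff (coeff P j) i\<close> is the coefficient of \<open>X\<^sup>i Y\<^sup>j\<close>.
\<close>

type_synonym bipoly = "complex poly poly"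

definition X :: bipoly where "X = [:[:0, 1:]:]"

definition Y :: bipoly where "Y = [:0, 1:]"

definition cscale :: "complex \<Rightarrow> bipoly \<Rightarrow> bipoly" (infixr "*\<^sub>C" 75)
  where "z *\<^sub>C P = smult [:z:] P"

definition eval2 :: "bipoly \<Rightarrow> complex \<Rightarrow> complex \<Rightarrow> complex"
  where "eval2 P x y = poly (poly P [:y:]) x"

text \<open>Nonzero homogeneous of degree exactly \<open>d\<close>.\<close>

definition homogeneous :: "nat \<Rightarrow> bipoly \<Rightarrow> bool"
  where "homogeneous d P \<longleftrightarrow> P \<noteq> 0 \<and> (\<forall>i j. coeff (coeff P j) i \<noteq> 0 \<longrightarrow> i + j = d)"

lemma eval2_simps [simp]:
  "eval2 X x y = x"
  "eval2 Y x y = y"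
  "eval2 (P + Q) x y = eval2 P x y + eval2 Q x y"
  "eval2 (P - Q) x y = eval2 P x y - eval2 Q x y"
  "eval2 (P * Q) x y = eval2 P x y * eval2 Q x y"
  "eval2 (P ^ n) x y = eval2 P x y ^ n"
  "eval2 (z *\<^sub>C P) x y = z * eval2 P x y"
  by (simp_all add: eval2_def X_def Y_def cscale_def poly_power)


section \<open>The explicit polynomials\<close>

text \<open>
  Each triple is \<open>(P\<^sub>0, P\<^sub>1, P\<^sub>\<infinity>)\<close>, with \<open>X\<close>, \<open>Y\<close> in place of \<open>u\<close>, \<open>v\<close>.
  The truncated subtraction in the exponent \<open>n - 2 * k - 1\<close> is harmless: it truncates only
  for \<open>2 * k + 1 > n\<close>, where the binomial coefficient vanishes.
\<close>

definition D1_forms :: "nat \<Rightarrow> bipoly \<times> bipoly \<times> bipoly" where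
  "D1_forms n =
    (\<i> *\<^sub>C (\<Sum>k=0..n div 2. of_nat (n choose (2 * k + 1)) * X ^ (n - 2 * k - 1)
                        * ((1 / (\<i> * of_nat n)) *\<^sub>C Y) ^ (2 * k + 1)),
     (\<Sum>k=0..n div 2. of_nat (n choose (2 * k)) * X ^ (n - 2 * k)
                        * ((1 / (\<i> * of_nat n)) *\<^sub>C Y) ^ (2 * k)),
     X^2 + (1 / of_nat n ^ 2) *\<^sub>C Y^2)"

definition D2_forms :: "nat \<Rightarrow> bipoly \<times> bipoly \<times> bipoly" where
  "D2_forms n =
    ((\<Sum>k=0..n div 2. of_nat (n choose (2 * k + 1)) * X ^ (n - 2 * k - 1)
                        * ((1 / of_nat n) *\<^sub>C Y) ^ (2 * k + 1)),
     X^2 - (1 / of_nat n ^ 2) *\<^sub>C Y^2,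
     (\<Sum>k=0..n div 2. of_nat (n choose (2 * k)) * X ^ (n - 2 * k)
                        * ((1 / of_nat n) *\<^sub>C Y) ^ (2 * k)))"

definition D3_forms :: "nat \<Rightarrow> bipoly \<times> bipoly \<times> bipoly" where
  "D3_forms n = (X * Y, X^n - (1/4) *\<^sub>C Y^n, X^n + (1/4) *\<^sub>C Y^n)"

definition T1_forms :: "bipoly \<times> bipoly \<times> bipoly" where
  "T1_forms =
    (X^5 * Y + (1/432) *\<^sub>C (X * Y^5),
     X^4 - (1/6) *\<^sub>C (X^2 * Y^2) - (1/432) *\<^sub>C (Y^4),
     X^4 + (1/6) *\<^sub>C (X^2 * Y^2) - (1/432) *\<^sub>C (Y^4))"

definition T2_forms :: "bipoly \<times> bipoly \<times> bipoly" where
  "T2_forms =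
    (X^3 * Y - (1/64) *\<^sub>C (Y^4),
     X^6 - (5/16) *\<^sub>C (X^3 * Y^3) - (1/512) *\<^sub>C (Y^6),
     X^4 + (1/8) *\<^sub>C (X * Y^3))"

definition T3_forms :: "bipoly \<times> bipoly \<times> bipoly" where
  "T3_forms =
    (X^3 * Y + (1/64) *\<^sub>C (Y^4),
     X^4 - (1/8) *\<^sub>C (X * Y^3),
     X^6 + (5/16) *\<^sub>C (X^3 * Y^3) - (1/512) *\<^sub>C (Y^6))"

definition O1_forms :: "bipoly \<times> bipoly \<times> bipoly" where
  "O1_forms =
    (X^11 * Y - (11/432) *\<^sub>C (X^9 * Y^3) + (11/3456) *\<^sub>C (X^7 * Y^5)
      + (11/165888) *\<^sub>C (X^5 * Y^7) - (11/47775744) *\<^sub>C (X^3 * Y^9)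
      + (1/254803968) *\<^sub>C (X * Y^11),
     X^8 - (7/36) *\<^sub>C (X^6 * Y^2) - (7/3456) *\<^sub>C (X^4 * Y^4) - (7/82944) *\<^sub>C (X^2 * Y^6)
      + (1/5308416) *\<^sub>C (Y^8),
     X^6 + (5/48) *\<^sub>C (X^4 * Y^2) - (5/2304) *\<^sub>C (X^2 * Y^4) - (1/110592) *\<^sub>C (Y^6))"

definition O2_forms :: "bipoly \<times> bipoly \<times> bipoly" where
  "O2_forms =
    (X^11 * Y + (11/432) *\<^sub>C (X^9 * Y^3) + (11/3456) *\<^sub>C (X^7 * Y^5)
      - (11/165888) *\<^sub>C (X^5 * Y^7) - (11/47775744) *\<^sub>C (X^3 * Y^9)
      - (1/254803968) *\<^sub>C (X * Y^11),
     X^6 - (5/48) *\<^sub>C (X^4 * Y^2) - (5/2304) *\<^sub>C (X^2 * Y^4) + (1/110592) *\<^sub>C (Y^6),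
     X^8 + (7/36) *\<^sub>C (X^6 * Y^2) - (7/3456) *\<^sub>C (X^4 * Y^4) + (7/82944) *\<^sub>C (X^2 * Y^6)
      + (1/5308416) *\<^sub>C (Y^8))"

definition O3_forms :: "bipoly \<times> bipoly \<times> bipoly" where
  "O3_forms =
    (X^7 * Y - (7/256) *\<^sub>C (X^4 * Y^4) - (1/8192) *\<^sub>C (X * Y^7),
     X^12 - (11/32) *\<^sub>C (X^9 * Y^3) - (11/262144) *\<^sub>C (X^3 * Y^9) - (1/67108864) *\<^sub>C (Y^12),
     X^6 + (5/64) *\<^sub>C (X^3 * Y^3) - (1/8192) *\<^sub>C (Y^6))"

definition O4_forms :: "bipoly \<times> bipoly \<times> bipoly" where
  "O4_forms =
    (X^7 * Y + (7/256) *\<^sub>C (X^4 * Y^4) - (1/8192) *\<^sub>C (X * Y^7),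
     X^6 - (5/64) *\<^sub>C (X^3 * Y^3) - (1/8192) *\<^sub>C (Y^6),
     X^12 + (11/32) *\<^sub>C (X^9 * Y^3) + (11/262144) *\<^sub>C (X^3 * Y^9) - (1/67108864) *\<^sub>C (Y^12))"

definition O5_forms :: "bipoly \<times> bipoly \<times> bipoly" where
  "O5_forms =
    (X^5 * Y - (1/108) *\<^sub>C (X * Y^5),
     X^12 - (11/36) *\<^sub>C (X^8 * Y^4) - (11/3888) *\<^sub>C (X^4 * Y^8) + (1/1259712) *\<^sub>C (Y^12),
     X^8 + (7/54) *\<^sub>C (X^4 * Y^4) + (1/11664) *\<^sub>C (Y^8))"

definition O6_forms :: "bipoly \<times> bipoly \<times> bipoly" where
  "O6_forms =
    (X^5 * Y + (1/108) *\<^sub>C (X * Y^5),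
     X^8 - (7/54) *\<^sub>C (X^4 * Y^4) + (1/11664) *\<^sub>C (Y^8),
     X^12 + (11/36) *\<^sub>C (X^8 * Y^4) - (11/3888) *\<^sub>C (X^4 * Y^8) - (1/1259712) *\<^sub>C (Y^12))"

definition I1_forms :: "bipoly \<times> bipoly \<times> bipoly" where
  "I1_forms =
    (X^29 * Y - (29/675) *\<^sub>C (X^27 * Y^3) + (1769/450000) *\<^sub>C (X^25 * Y^5)
      + (29/337500) *\<^sub>C (X^23 * Y^7) + (667/540000000) *\<^sub>C (X^21 * Y^9)
      - (667/72900000000) *\<^sub>C (X^19 * Y^11) + (12673/29160000000000) *\<^sub>C (X^17 * Y^13)
      - (12673/524880000000000000) *\<^sub>C (X^13 * Y^17)
      + (667/23619600000000000000) *\<^sub>C (X^11 * Y^19)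
      - (667/3149280000000000000000) *\<^sub>C (X^9 * Y^21)
      - (29/35429400000000000000000) *\<^sub>C (X^7 * Y^23)
      - (1769/850305600000000000000000000) *\<^sub>C (X^5 * Y^25)
      + (29/22958251200000000000000000000) *\<^sub>C (X^3 * Y^27)
      - (1/612220032000000000000000000000) *\<^sub>C (X * Y^29),
     X^20 - (19/90) *\<^sub>C (X^18 * Y^2) - (19/18000) *\<^sub>C (X^16 * Y^4)
      - (19/135000) *\<^sub>C (X^14 * Y^6) - (247/162000000) *\<^sub>C (X^12 * Y^8)
      + (247/14580000000) *\<^sub>C (X^10 * Y^10) - (247/2916000000000) *\<^sub>C (X^8 * Y^12)
      - (19/43740000000000) *\<^sub>C (X^6 * Y^14) - (19/104976000000000000) *\<^sub>C (X^4 * Y^16)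
      - (19/9447840000000000000) *\<^sub>C (X^2 * Y^18) + (1/1889568000000000000000) *\<^sub>C (Y^20),
     X^12 + (11/150) *\<^sub>C (X^10 * Y^2) - (11/6000) *\<^sub>C (X^8 * Y^4)
      - (11/1350000) *\<^sub>C (X^6 * Y^6) - (11/108000000) *\<^sub>C (X^4 * Y^8)
      + (11/48600000000) *\<^sub>C (X^2 * Y^10) + (1/5832000000000) *\<^sub>C (Y^12))"

definition I6_forms :: "bipoly \<times> bipoly \<times> bipoly" where
  "I6_forms =
    (X^11 * Y + (11/1728) *\<^sub>C (X^6 * Y^6) - (1/2985984) *\<^sub>C (X * Y^11),
     X^20 - (19/144) *\<^sub>C (X^15 * Y^5) + (247/1492992) *\<^sub>C (X^10 * Y^10)
      + (19/429981696) *\<^sub>C (X^5 * Y^15) + (1/8916100448256) *\<^sub>C (Y^20),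
     X^30 + (29/96) *\<^sub>C (X^25 * Y^5) - (3335/995328) *\<^sub>C (X^20 * Y^10)
      - (3335/2972033482752) *\<^sub>C (X^10 * Y^20) - (29/855945643032576) *\<^sub>C (X^5 * Y^25)
      + (1/26623333280885243904) *\<^sub>C (Y^30))"

text \<open>
  No formula is imposed for the remaining triples \<open>[2,5,3]\<close>, \<open>[3,2,5]\<close>, \<open>[3,5,2]\<close>, \<open>[5,2,3]\<close>.
  The triple \<open>[2,2,2]\<close> is covered by the first three clauses at \<open>n = 2\<close>, whose right-hand sides
  agree there (see \<open>D_forms_2\<close>).
\<close>

definition explicit_forms :: "nat \<times> nat \<times> nat \<Rightarrow> bipoly \<times> bipoly \<times> bipoly \<Rightarrow> bool" where
  "explicit_forms k P \<longleftrightarrow>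
     (\<forall>n\<ge>2. k = (2, 2, n) \<longrightarrow> P = D1_forms n) \<and>
     (\<forall>n\<ge>2. k = (2, n, 2) \<longrightarrow> P = D2_forms n) \<and>
     (\<forall>n\<ge>2. k = (n, 2, 2) \<longrightarrow> P = D3_forms n) \<and>
     (k = (2, 3, 3) \<longrightarrow> P = T1_forms) \<and>
     (k = (3, 2, 3) \<longrightarrow> P = T2_forms) \<and>
     (k = (3, 3, 2) \<longrightarrow> P = T3_forms) \<and>
     (k = (2, 3, 4) \<longrightarrow> P = O1_forms) \<and>
     (k = (2, 4, 3) \<longrightarrow> P = O2_forms) \<and>
     (k = (3, 2, 4) \<longrightarrow> P = O3_forms) \<and>
     (k = (3, 4, 2) \<longrightarrow> P = O4_forms) \<and>
     (k = (4, 2, 3) \<longrightarrow> P = O5_forms) \<and>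
     (k = (4, 3, 2) \<longrightarrow> P = O6_forms) \<and>
     (k = (2, 3, 5) \<longrightarrow> P = I1_forms) \<and>
     (k = (5, 3, 2) \<longrightarrow> P = I6_forms)"

lemma D_forms_2: "D1_forms 2 = D3_forms 2" "D2_forms 2 = D3_forms 2"
  by (simp_all add: D1_forms_def D2_forms_def D3_forms_def X_def Y_def cscale_def
        power2_eq_square numeral_poly)


section \<open>Hypergeometric function and Kummer solutions at the origin\<close>

definition hyperF :: "real \<Rightarrow> real \<Rightarrow> real \<Rightarrow> complex \<Rightarrow> complex" where
  "hyperF a b c x =
     (\<Sum>n. complex_of_real (pochhammer a n * pochhammer b n / (pochhammer c n * pochhammer 1 n)) * x ^ n)"

lemma hyperF_eq_fps_hypergeo:
  "hyperF a b c x =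
     eval_fps (fps_hypergeo [complex_of_real a, complex_of_real b] [complex_of_real c] 1) x"
  by (simp add: hyperF_def eval_fps_def pochhammer_of_real pochhammer_fact [symmetric])

text \<open>The power \<open>z\<^sup>s\<close> determined by the choice \<open>l\<close> of a logarithm of \<open>z\<close>.\<close>

definition zpow :: "complex \<Rightarrow> real \<Rightarrow> complex"
  where "zpow l s = exp (complex_of_real s * l)"

text \<open>In \<open>kummer_v\<close> the argument \<open>l0\<close> is the chosen logarithm of \<open>x\<close>.\<close>

definition kummer_u :: "real \<Rightarrow> real \<Rightarrow> real \<Rightarrow> complex \<Rightarrow> complex"
  where "kummer_u a b c x = hyperF a b c x"

definition kummer_v :: "real \<Rightarrow> real \<Rightarrow> real \<Rightarrow> complex \<Rightarrow> complex \<Rightarrow> complex"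
  where "kummer_v a b c l0 x = zpow l0 (1 - c) * hyperF (a - c + 1) (b - c + 1) (2 - c) x"

text \<open>
  Simultaneous analytic continuation of \<open>log x\<close>, \<open>log (1 - x)\<close> and the two Kummer solutions.
  Since these are multivalued on \<open>\<complex> - {0, 1}\<close>, the functions live on a connected parameter domain
  \<open>\<Omega>\<close> with a holomorphic map \<open>x\<close> from \<open>\<Omega>\<close> to \<open>\<complex> - {0, 1}\<close> (for instance \<open>x = id\<close> on a plane
  domain, or the universal covering by the unit disc, which captures continuation along all
  paths). On some nonempty open part \<open>W\<close> of \<open>\<Omega>\<close> they are the original germs: \<open>\<bar>x\<bar> < 1\<close>, the
  logarithm of \<open>1 - x\<close> is the one vanishing at \<open>x = 0\<close>, and \<open>u\<close>, \<open>v\<close> are given by the series.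
\<close>

definition kummer_continuation ::
  "real \<Rightarrow> real \<Rightarrow> real \<Rightarrow> complex set \<Rightarrow> (complex \<Rightarrow> complex) \<Rightarrow> (complex \<Rightarrow> complex) \<Rightarrow>
   (complex \<Rightarrow> complex) \<Rightarrow> (complex \<Rightarrow> complex) \<Rightarrow> (complex \<Rightarrow> complex) \<Rightarrow> bool"
where
  "kummer_continuation a b c \<Omega> x l0 l1 u v \<longleftrightarrow>
     open \<Omega> \<and> connected \<Omega> \<and>
     x holomorphic_on \<Omega> \<and> l0 holomorphic_on \<Omega> \<and> l1 holomorphic_on \<Omega> \<and>
     u holomorphic_on \<Omega> \<and> v holomorphic_on \<Omega> \<and>
     (\<forall>t\<in>\<Omega>. exp (l0 t) = x t \<and> exp (l1 t) = 1 - x t) \<and>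
     (\<exists>W. open W \<and> W \<noteq> {} \<and> W \<subseteq> \<Omega> \<and>
        (\<forall>t\<in>W. norm (x t) < 1 \<and> l1 t = Ln (1 - x t) \<and>
               u t = kummer_u a b c (x t) \<and> v t = kummer_v a b c (l0 t) (x t)))"


section \<open>Sign patterns and right-hand sides\<close>

datatype sign_case = Case_i | Case_ii | Case_iii | Case_iv

text \<open>Arguments \<open>\<mu>\<^sub>0\<close>, \<open>\<mu>\<^sub>1\<close>, \<open>\<mu>\<^sub>\<infinity>\<close>.\<close>

fun sign_pattern :: "sign_case \<Rightarrow> real \<Rightarrow> real \<Rightarrow> real \<Rightarrow> bool" where
  "sign_pattern Case_i   m0 m1 minf \<longleftrightarrow> m0 > 0 \<and> m1 > 0 \<and> minf > 0"
| "sign_pattern Case_ii  m0 m1 minf \<longleftrightarrow> m0 > 0 \<and> m1 < 0 \<and> minf < 0"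
| "sign_pattern Case_iii m0 m1 minf \<longleftrightarrow> m0 < 0 \<and> m1 > 0 \<and> minf < 0"
| "sign_pattern Case_iv  m0 m1 minf \<longleftrightarrow> m0 < 0 \<and> m1 < 0 \<and> minf > 0"

fun UV :: "sign_case \<Rightarrow> complex \<Rightarrow> complex \<Rightarrow> complex \<times> complex" where
  "UV Case_i   u v = (u, v)"
| "UV Case_ii  u v = (u, v)"
| "UV Case_iii u v = (v, u)"
| "UV Case_iv  u v = (v, u)"

text \<open>
  The triple \<open>(f\<^sub>0, f\<^sub>1, f\<^sub>\<infinity>)\<close>, where \<open>l0\<close> and \<open>l1\<close> are the chosen logarithms of \<open>x\<close> and \<open>1 - x\<close>.
\<close>

fun rhs :: "sign_case \<Rightarrow> nat \<times> nat \<times> nat \<Rightarrow> nat \<Rightarrow> complex \<Rightarrow> complex \<Rightarrow> complex \<times> complex \<times> complex"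
where
  "rhs Case_i (k0, k1, kinf) N l0 l1 =
     (zpow l0 (1 / real k0),
      zpow l1 (1 / real k1),
      1)"
| "rhs Case_ii (k0, k1, kinf) N l0 l1 =
     (zpow l0 (1 / real k0) * zpow l1 (- real N / (real k0 * real k1)),
      zpow l1 (1 / real k1 - real N / real k1 ^ 2),
      zpow l1 (- real N / (real k1 * real kinf)))"
| "rhs Case_iii (k0, k1, kinf) N l0 l1 =
     (zpow l0 (1 / real k0 - real N / real k0 ^ 2),
      zpow l0 (- real N / (real k0 * real k1)) * zpow l1 (1 / real k1),
      zpow l0 (- real N / (real k0 * real kinf)))"
| "rhs Case_iv (k0, k1, kinf) N l0 l1 =
     (zpow l0 (1 / real k0 - real N / real k0 ^ 2) * zpow l1 (- real N / (real k0 * real k1)),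
      zpow l0 (- real N / (real k0 * real k1)) * zpow l1 (1 / real k1 - real N / real k1 ^ 2),
      zpow l0 (- real N / (real k0 * real kinf)) * zpow l1 (- real N / (real k1 * real kinf)))"

fun identities ::
  "sign_case \<Rightarrow> nat \<times> nat \<times> nat \<Rightarrow> nat \<Rightarrow> bipoly \<times> bipoly \<times> bipoly \<Rightarrow>
   complex \<Rightarrow> complex \<Rightarrow> complex \<Rightarrow> complex \<Rightarrow> bool"
where
  "identities s k N (P0, P1, Pinf) l0 l1 u v \<longleftrightarrow>
     (let (U, V) = UV s u v
      in (eval2 P0 U V, eval2 P1 U V, eval2 Pinf U V) = rhs s k N l0 l1)"

end

(* In the coordinate t = x^(1/k0) the hypergeometric equation is regular at t = 0. Normalise the exponents as in
   case (i) and put f = Pinf(1,z), g = P0(1,z), h = P1(1,z), d = deg Pinf. The map tau = g / f^(kinf/k0) should invert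
   the Schwarz map z = v/u. Instead of inverting anything, one pulls a solution w back along tau: the Jacobian of
   P0, Pinf and the Hessian of Pinf being powers of the forms, (w(tau) f^(1/d))'' = 0, so that w(tau) f^(1/d) =
   w(0) + w'(0) z. For w = u, v this reads u f^(1/d) = 1 and v f^(1/d) = z, and homogeneity gives the three identities
   on the open image of tau. Case (ii) follows by multiplying the solutions by (1 - x)^(1/k1) (Euler's
   transformation), cases (iii), (iv) by exchanging the two Kummer solutions. *)

theory Submission
  imports Defs "HOL-Real_Asymp.Real_Asymp"
begin

section \<open>The hypergeometric equation\<close>

text \<open>Why a Jacobian and a Hessian are what is needed: once the equation has eliminated
  w''(tau), (w(tau) f^(1/d))'' is a combination of w'(tau) and w(tau). The coefficient of w'
  contains only first derivatives of the forms and vanishes by the Jacobians together with the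
  relation defining N. The coefficient of w contains f'' through d f f'' - (d - 1) f'^2, and (d - 1)
  times this expression is the Hessian of Pinf at (1, z). No invariant theory of the polyhedral
  groups enters: any three forms with the syzygy, one Jacobian and one Hessian relation will do.
  Outside the dihedral series these are identities between concrete polynomials in y = z^k0 / c,
  settled by computation. The identity for P1 needs an extra argument: the syzygy determines only
  its k1-th power, and the branch is found by connectedness of the disc.\<close>

lemma hyperF_0 [simp]: "hyperF a b c 0 = 1"
  unfolding hyperF_def using powser_zero[of "\<lambda>n. complex_of_real
    (pochhammer a n * pochhammer b n / (pochhammer c n * pochhammer 1 n))"] by simp

lemma hyperF_commute: "hyperF a b c = hyperF b a c"
  by (simp add: hyperF_def fun_eq_iff mult.commute)

lemma not_nonpos_Int: "x > -1 \<Longrightarrow> x \<noteq> 0 \<Longrightarrow> x \<notin> \<int>\<^sub>\<le>\<^sub>0" for x :: real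
  by (auto elim!: nonpos_Ints_cases)

text \<open>The assumptions keep every coefficient well defined and nonzero, so the limit of
  coefficient ratios gives radius of convergence 1. The equation is the recursion of the
  coefficients, proved for formal power series and then evaluated in the disc.\<close>

lemma hyperF_solves_hypergeometric_equation:
  fixes a b c :: real
  assumes nz: "a \<notin> \<int>\<^sub>\<le>\<^sub>0" "b \<notin> \<int>\<^sub>\<le>\<^sub>0" "c \<notin> \<int>\<^sub>\<le>\<^sub>0"
  obtains F1 F2 :: "complex \<Rightarrow> complex" where
    "\<And>x. norm x < 1 \<Longrightarrow> (hyperF a b c has_field_derivative F1 x) (at x)"
    "\<And>x. norm x < 1 \<Longrightarrow> (F1 has_field_derivative F2 x) (at x)"
    "\<And>x. norm x < 1 \<Longrightarrow> x * (1 - x) * F2 x + (complex_of_real c - complex_of_real (a + b + 1) * x) * F1 x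
       = complex_of_real (a * b) * hyperF a b c x"
proof -
  define \<alpha> where "\<alpha> = (\<lambda>n. pochhammer a n * pochhammer b n / (pochhammer c n * pochhammer 1 n))"
  define P where "P = Abs_fps (\<lambda>n. complex_of_real (\<alpha> n))"
  have shift: "real n + x \<noteq> 0" if "x \<notin> \<int>\<^sub>\<le>\<^sub>0" for n x
    using that by (metis add.commute add_0 add_eq_0_iff minus_of_nat_in_nonpos_Ints of_nat_0)
  have poch_nz: "pochhammer x n \<noteq> 0" if "x \<notin> \<int>\<^sub>\<le>\<^sub>0" for n and x :: real
    using that pochhammer_eq_0_imp_nonpos_Int by blast
  have \<alpha>_nz: "\<alpha> n \<noteq> 0" for n
    using poch_nz[OF nz(1)] poch_nz[OF nz(2)] poch_nz[OF nz(3)]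
    by (simp add: \<alpha>_def pochhammer_fact [symmetric])
  have rec: "\<alpha> (Suc n) * ((c + n) * (n + 1)) = \<alpha> n * ((a + n) * (b + n))" for n
    using shift[OF nz(3), of n] poch_nz[OF nz(3), of n]
    by (simp add: \<alpha>_def pochhammer_Suc pochhammer_fact [symmetric] divide_simps add.commute)
  have quot: "\<alpha> n / \<alpha> (Suc n) = (c + n) * (n + 1) / ((a + n) * (b + n))" for n
    using rec[of n] \<alpha>_nz[of "Suc n"] shift[OF nz(1), of n] shift[OF nz(2), of n]
    by (subst frac_eq_eq) (auto simp: add.commute mult.commute)
  have lim: "(\<lambda>n. \<alpha> n / \<alpha> (Suc n)) \<longlonglongrightarrow> 1"
    unfolding quot by real_asymp
  have rad: "fps_conv_radius P = 1"
  proof -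
    have "(\<lambda>n. norm (complex_of_real (\<alpha> n)) / norm (complex_of_real (\<alpha> (Suc n)))) \<longlonglongrightarrow> \<bar>1\<bar>"
      using tendsto_rabs[OF lim] by (simp add: abs_divide)
    then have "conv_radius (\<lambda>n. complex_of_real (\<alpha> n)) = ereal 1"
      by (intro conv_radius_ratio_limit_nonzero) (simp_all add: \<alpha>_nz)
    then show ?thesis by (simp add: fps_conv_radius_def P_def one_ereal_def)
  qed
  have eval: "hyperF a b c = eval_fps P"
    by (simp add: hyperF_def eval_fps_def P_def \<alpha>_def fun_eq_iff)
  have ode: "fps_X * (1 - fps_X) * fps_deriv (fps_deriv P)
      + (fps_const (complex_of_real c) - fps_const (complex_of_real (a + b + 1)) * fps_X) * fps_deriv P
      = fps_const (complex_of_real (a * b)) * P"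
  proof (rule fps_ext)
    fix n
    have rec': "complex_of_real (\<alpha> (Suc n)) * ((c + n) * (n + 1)) = \<alpha> n * ((a + n) * (b + n))"
      using arg_cong[OF rec[of n], of complex_of_real] by simp
    show "(fps_X * (1 - fps_X) * fps_deriv (fps_deriv P)
      + (fps_const (complex_of_real c) - fps_const (complex_of_real (a + b + 1)) * fps_X) * fps_deriv P) $ n
      = (fps_const (complex_of_real (a * b)) * P) $ n"
    \<comment> \<open>The factor x (1 - x) reaches back two indices, so 0 and 1 are treated
      apart.\<close>
    proof (cases n)
      case 0
      then show ?thesis using rec'
        by (simp add: P_def algebra_simps fps_mult_nth_0)
    next
      case (Suc m)
      show ?thesis
      proof (cases m)
        case 0
        then show ?thesis using rec' Suc
          by (simp add: P_def algebra_simps fps_X_mult_nth)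
      next
        case (Suc l)
        then show ?thesis using rec' \<open>n = Suc m\<close>
          by (simp add: P_def algebra_simps fps_X_mult_nth)
      qed
    qed
  qed
  show thesis
  proof (rule that)
    fix x :: complex assume x: "norm x < 1"
    then have x': "ereal (norm x) < fps_conv_radius P" by (simp add: rad one_ereal_def)
    then have x1: "ereal (norm x) < fps_conv_radius (fps_deriv P)"
      using fps_conv_radius_deriv[of P] by order
    then have x2: "ereal (norm x) < fps_conv_radius (fps_deriv (fps_deriv P))"
      using fps_conv_radius_deriv[of "fps_deriv P"] by order
    show "(hyperF a b c has_field_derivative eval_fps (fps_deriv P) x) (at x)"
      unfolding eval by (rule has_field_derivative_eval_fps[OF x'])
    show "(eval_fps (fps_deriv P) has_field_derivative eval_fps (fps_deriv (fps_deriv P)) x) (at x)"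
      by (rule has_field_derivative_eval_fps[OF x1])
    define q1 q2 :: "complex fps" where "q1 = fps_X * (1 - fps_X)"
      and "q2 = fps_const (complex_of_real c) - fps_const (complex_of_real (a + b + 1)) * fps_X"
    have q: "q1 = fps_of_poly [:0, 1, -1:]" "q2 = fps_of_poly [:complex_of_real c, - complex_of_real (a + b + 1):]"
      by (simp_all add: q1_def q2_def fps_of_poly_pCons algebra_simps fps_const_neg [symmetric] del: fps_const_neg)
    have rq: "fps_conv_radius q1 = \<infinity>" "fps_conv_radius q2 = \<infinity>"
      by (simp_all add: q)
    have eq: "eval_fps q1 x = x * (1 - x)" "eval_fps q2 x = complex_of_real c - complex_of_real (a + b + 1) * x"
      by (simp_all add: q eval_fps_of_poly algebra_simps)
    have "eval_fps (q1 * fps_deriv (fps_deriv P) + q2 * fps_deriv P) x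
        = eval_fps q1 x * eval_fps (fps_deriv (fps_deriv P)) x + eval_fps q2 x * eval_fps (fps_deriv P) x"
    proof -
      have "ereal (norm x) < fps_conv_radius (q1 * fps_deriv (fps_deriv P))"
           "ereal (norm x) < fps_conv_radius (q2 * fps_deriv P)"
        using fps_conv_radius_mult[of q1 "fps_deriv (fps_deriv P)"] fps_conv_radius_mult[of q2 "fps_deriv P"]
          rq x1 x2 by auto
      then show ?thesis using rq x1 x2 by (simp add: eval_fps_add eval_fps_mult)
    qed
    moreover have "eval_fps (fps_const (complex_of_real (a * b)) * P) x = complex_of_real (a * b) * eval_fps P x"
      using x' by (subst eval_fps_mult) auto
    ultimately show "x * (1 - x) * eval_fps (fps_deriv (fps_deriv P)) x
        + (complex_of_real c - complex_of_real (a + b + 1) * x) * eval_fps (fps_deriv P) x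
        = complex_of_real (a * b) * hyperF a b c x"
      using arg_cong[OF ode, of "\<lambda>p. eval_fps p x"] unfolding eval q1_def[symmetric] q2_def[symmetric] eq
      by simp
  qed
qed

section \<open>The equation in the local uniformizer\<close>

text \<open>With \<open>x = t ^ k\<close> and \<open>c = 1 - 1 / k\<close> the hypergeometric equation becomes regular at \<open>t = 0\<close>:
  the exponents \<open>0\<close>, \<open>1 / k\<close> at \<open>x = 0\<close> turn into \<open>0\<close>, \<open>1\<close>.\<close>

definition solves_uniformized :: "nat \<Rightarrow> complex \<Rightarrow> complex \<Rightarrow> (complex \<Rightarrow> complex) \<Rightarrow> bool" where
  "solves_uniformized k A M w \<longleftrightarrow> (\<exists>w1 w2. \<forall>t. norm t < 1 \<longrightarrow>
     (w has_field_derivative w1 t) (at t) \<and> (w1 has_field_derivative w2 t) (at t) \<and>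
     (1 - t ^ k) * w2 t = t ^ (k - 2) * (A * t * w1 t + M * w t))"

lemma DERIV_power_arg:
  assumes "(F has_field_derivative D) (at (t ^ k))"
  shows "((\<lambda>t. F (t ^ k)) has_field_derivative D * (of_nat k * t ^ (k - 1))) (at t)"
  by (rule DERIV_chain2[where f = F and g = "\<lambda>t. t ^ k", OF assms]) (auto intro!: derivative_eq_intros)

lemma norm_power_less_1:
  fixes t :: "'a :: real_normed_div_algebra"
  shows "norm t < 1 \<Longrightarrow> k > 0 \<Longrightarrow> norm (t ^ k) < 1"
  by (simp add: norm_power power_less_one_iff)

lemma one_minus_in_slit_plane:
  fixes z :: complex
  assumes "norm z < 1"
  shows "1 - z \<notin> \<real>\<^sub>\<le>\<^sub>0" "1 - z \<noteq> 0"
proof -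
  have "Re z < 1" using assms complex_Re_le_cmod[of z] by linarith
  then show "1 - z \<notin> \<real>\<^sub>\<le>\<^sub>0" by (simp add: complex_nonpos_Reals_iff)
  then show "1 - z \<noteq> 0" by auto
qed

lemma solves_uniformized_holomorphic:
  "solves_uniformized k A M w \<Longrightarrow> w holomorphic_on ball 0 1"
  unfolding solves_uniformized_def by (auto simp: holomorphic_on_open)

lemma solves_uniformized_exponent_0:
  fixes a b c :: real
  assumes k: "k \<ge> 2" and c: "c = 1 - 1 / real k"
    and nz: "a \<notin> \<int>\<^sub>\<le>\<^sub>0" "b \<notin> \<int>\<^sub>\<le>\<^sub>0"
  shows "solves_uniformized k (of_real (1 + k * (a + b))) (of_real (real k ^ 2 * a * b)) (\<lambda>t. hyperF a b c (t ^ k))"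
    and "deriv (\<lambda>t. hyperF a b c (t ^ k)) 0 = 0"
proof -
  have "c > 0" using k by (simp add: c)
  then have cnz: "c \<notin> \<int>\<^sub>\<le>\<^sub>0" by (auto elim!: nonpos_Ints_cases)
  obtain F1 F2 where F: "\<And>x. norm x < 1 \<Longrightarrow> (hyperF a b c has_field_derivative F1 x) (at x)"
    "\<And>x. norm x < 1 \<Longrightarrow> (F1 has_field_derivative F2 x) (at x)"
    and ode: "\<And>x. norm x < 1 \<Longrightarrow> x * (1 - x) * F2 x + (of_real c - of_real (a + b + 1) * x) * F1 x
       = of_real (a * b) * hyperF a b c x"
    using hyperF_solves_hypergeometric_equation[OF nz cnz] by metis
  obtain m where m: "k = m + 2" using k nat_le_iff_add by auto
  have kc: "of_nat k \<noteq> (0::complex)" using k by auto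
  have cc: "of_real c = 1 - 1 / (of_nat k :: complex)" by (simp add: c)
  define w1 where "w1 = (\<lambda>t. of_nat k * t ^ (m + 1) * F1 (t ^ k))"
  define w2 where "w2 = (\<lambda>t. of_nat k * (of_nat (m + 1) * t ^ m * F1 (t ^ k)
    + of_nat k * t ^ (m + 1) * t ^ (m + 1) * F2 (t ^ k)))"
  have d1: "((\<lambda>t. hyperF a b c (t ^ k)) has_field_derivative w1 t) (at t)" if "norm t < 1" for t
  proof -
    have "norm (t ^ k) < 1" using norm_power_less_1[OF that, of k] k by simp
    from DERIV_power_arg[OF F(1)[OF this]] show ?thesis unfolding w1_def
      by (simp add: m algebra_simps)
  qed
  have d2: "(w1 has_field_derivative w2 t) (at t)" if "norm t < 1" for t
  proof -
    have "norm (t ^ k) < 1" using norm_power_less_1[OF that, of k] k by simp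
    note F1 = DERIV_power_arg[OF F(2)[OF this]]
    show ?thesis unfolding w1_def w2_def
      by (rule derivative_eq_intros F1 refl)+ (simp add: m algebra_simps)
  qed
  have eq: "(1 - t ^ k) * w2 t = t ^ (k - 2) * (of_real (1 + k * (a + b)) * t * w1 t
      + of_real (real k ^ 2 * a * b) * hyperF a b c (t ^ k))" if "norm t < 1" for t
  proof -
    define x where "x = t ^ k"
    have "norm x < 1" using norm_power_less_1[OF that, of k] k by (simp add: x_def)
    have 1: "of_nat k ^ 2 * (x * (1 - x) * F2 x + (of_real c - of_real (a + b + 1) * x) * F1 x)
        = of_nat k ^ 2 * (of_real (a * b) * hyperF a b c x)"
      using ode[OF \<open>norm x < 1\<close>] by simp
    \<comment> \<open>Here the choice of \<open>c\<close> enters: k^2 c = k (k - 1) matches the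
      factor that arises from differentiating t^(k - 1), so that t^(k - 2) can be split off from
      both sides.\<close>
    have 2: "of_nat k ^ 2 * of_real c = (of_nat k * (of_nat k - 1) :: complex)"
      using kc by (simp add: cc field_simps power2_eq_square)
    have t: "t ^ (m + 1) * t ^ (m + 1) = t ^ m * x" "t * t ^ (m + 1) = x"
      by (simp_all add: x_def m power_add)
    have "(1 - t ^ k) * w2 t = t ^ m * ((1 - x) * (of_nat k * (of_nat k - 1) * F1 x + of_nat k ^ 2 * x * F2 x))"
    proof -
      have "w2 t = of_nat k * (of_nat (m + 1) * t ^ m * F1 x + of_nat k * (t ^ (m + 1) * t ^ (m + 1)) * F2 x)"
        by (simp only: w2_def x_def mult.assoc)
      then have "w2 t = of_nat k * (of_nat (m + 1) * t ^ m * F1 x + of_nat k * (t ^ m * x) * F2 x)"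
        by (simp only: t)
      then show ?thesis unfolding x_def[symmetric] by (simp add: m algebra_simps power2_eq_square)
    qed
    also have "\<dots> = t ^ m * (of_real (1 + k * (a + b)) * of_nat k * x * F1 x + of_nat k ^ 2 * of_real a * of_real b * hyperF a b c x)"
    proof -
      have "(1 - x) * (of_nat k * (of_nat k - 1) * F1 x + of_nat k ^ 2 * x * F2 x)
        = of_real (1 + k * (a + b)) * of_nat k * x * F1 x + of_nat k ^ 2 * of_real a * of_real b * hyperF a b c x"
        using 1 2 by (simp add: algebra_simps power2_eq_square) algebra
      then show ?thesis by simp
    qed
    also have "\<dots> = t ^ (k - 2) * (of_real (1 + k * (a + b)) * t * w1 t
      + of_real (real k ^ 2 * a * b) * hyperF a b c (t ^ k))"
    proof -
      have "t * w1 t = of_nat k * x * F1 x"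
        unfolding w1_def x_def[symmetric] t(2)[symmetric] by (simp add: algebra_simps)
      then have *: "of_real (1 + k * (a + b)) * t * w1 t = of_real (1 + k * (a + b)) * (of_nat k * x * F1 x)"
        by (simp only: mult.assoc)
      show ?thesis unfolding x_def[symmetric] * by (simp add: m mult.assoc)
    qed
    finally show ?thesis .
  qed
  show "solves_uniformized k (of_real (1 + k * (a + b))) (of_real (real k ^ 2 * a * b)) (\<lambda>t. hyperF a b c (t ^ k))"
    unfolding solves_uniformized_def using d1 d2 eq by blast
  show "deriv (\<lambda>t. hyperF a b c (t ^ k)) 0 = 0"
    using DERIV_imp_deriv[OF d1, of 0] by (simp add: w1_def)
qed

text \<open>This is the second Kummer solution: x^(1 - c) = t, so it becomes single-valued in t.
  With the solution of exponent 0 it forms the basis with initial data (1, 0) and (0, 1), the only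
  normalization used later.\<close>

lemma solves_uniformized_exponent_1:
  fixes a b :: real and k :: nat
  defines "G \<equiv> hyperF (a + 1 / real k) (b + 1 / real k) (1 + 1 / real k)"
  assumes k: "k \<ge> 2" and nz: "a + 1 / real k \<notin> \<int>\<^sub>\<le>\<^sub>0" "b + 1 / real k \<notin> \<int>\<^sub>\<le>\<^sub>0"
  shows "solves_uniformized k (of_real (1 + k * (a + b))) (of_real (real k ^ 2 * a * b)) (\<lambda>t. t * G (t ^ k))"
    and "deriv (\<lambda>t. t * G (t ^ k)) 0 = 1"
proof -
  have "1 + 1 / real k > 0" by (simp add: add_pos_nonneg)
  then have cnz: "1 + 1 / real k \<notin> \<int>\<^sub>\<le>\<^sub>0" by (auto elim!: nonpos_Ints_cases)
  obtain F1 F2 where F: "\<And>x. norm x < 1 \<Longrightarrow> (G has_field_derivative F1 x) (at x)"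
    "\<And>x. norm x < 1 \<Longrightarrow> (F1 has_field_derivative F2 x) (at x)"
    and ode: "\<And>x. norm x < 1 \<Longrightarrow> x * (1 - x) * F2 x + (of_real (1 + 1 / real k)
        - of_real (a + 1 / real k + (b + 1 / real k) + 1) * x) * F1 x
       = of_real ((a + 1 / real k) * (b + 1 / real k)) * G x"
    using hyperF_solves_hypergeometric_equation[OF nz cnz] unfolding G_def by metis
  obtain m where m: "k = m + 2" using k nat_le_iff_add by auto
  have kc: "of_nat k \<noteq> (0::complex)" using k by auto
  define w1 where "w1 = (\<lambda>t. G (t ^ k) + of_nat k * t ^ k * F1 (t ^ k))"
  define w2 where "w2 = (\<lambda>t. t ^ (m + 1) * (of_nat k * (of_nat k + 1) * F1 (t ^ k)
    + of_nat k ^ 2 * t ^ k * F2 (t ^ k)))"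
  have d1: "((\<lambda>t. t * G (t ^ k)) has_field_derivative w1 t) (at t)" if "norm t < 1" for t
  proof -
    have "norm (t ^ k) < 1" using norm_power_less_1[OF that, of k] k by simp
    note G = DERIV_power_arg[OF F(1)[OF this]]
    show ?thesis unfolding w1_def
      by (rule derivative_eq_intros G refl)+ (simp add: m algebra_simps)
  qed
  have d2: "(w1 has_field_derivative w2 t) (at t)" if "norm t < 1" for t
  proof -
    have "norm (t ^ k) < 1" using norm_power_less_1[OF that, of k] k by simp
    note G = DERIV_power_arg[OF F(1)[OF this]] and F1 = DERIV_power_arg[OF F(2)[OF this]]
    show ?thesis unfolding w1_def w2_def
      by (rule derivative_eq_intros G F1 refl)+ (simp add: m algebra_simps power2_eq_square power_add)
  qed
  have eq: "(1 - t ^ k) * w2 t = t ^ (k - 2) * (of_real (1 + k * (a + b)) * t * w1 t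
      + of_real (real k ^ 2 * a * b) * (t * G (t ^ k)))" if "norm t < 1" for t
  proof -
    define x where "x = t ^ k"
    have "norm x < 1" using norm_power_less_1[OF that, of k] k by (simp add: x_def)
    define i where "i = 1 / (of_nat k :: complex)"
    have i: "of_nat k * i = 1" using kc by (simp add: i_def)
    have "x * (1 - x) * F2 x + (1 + i - (of_real a + i + (of_real b + i) + 1) * x) * F1 x
       = (of_real a + i) * (of_real b + i) * G x"
      using ode[OF \<open>norm x < 1\<close>] by (simp add: i_def)
    then have *: "(1 - x) * (of_nat k * (of_nat k + 1) * F1 x + of_nat k ^ 2 * x * F2 x)
        = (1 + of_nat k * (of_real a + of_real b)) * (G x + of_nat k * x * F1 x)
          + of_nat k ^ 2 * of_real a * of_real b * G x"
      using i by algebra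
    have "(1 - t ^ k) * w2 t = t ^ (m + 1) * ((1 - x) * (of_nat k * (of_nat k + 1) * F1 x + of_nat k ^ 2 * x * F2 x))"
      unfolding w2_def x_def[symmetric] by (rule mult.left_commute)
    then show ?thesis unfolding * w1_def x_def[symmetric]
      by (simp add: m ring_distribs mult_ac)
  qed
  show "solves_uniformized k (of_real (1 + k * (a + b))) (of_real (real k ^ 2 * a * b)) (\<lambda>t. t * G (t ^ k))"
    unfolding solves_uniformized_def using d1 d2 eq by blast
  show "deriv (\<lambda>t. t * G (t ^ k)) 0 = 1"
    using DERIV_imp_deriv[OF d1, of 0] k by (simp add: w1_def G_def power_0_left)
qed

text \<open>Euler's transformation at the level of differential equations.\<close>

lemma solves_uniformized_Euler:
  fixes s :: real
  assumes k: "k \<ge> 2" and w: "solves_uniformized k (of_real ((1 + s) * k)) M w"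
  defines "p \<equiv> \<lambda>t. zpow (Ln (1 - t ^ k)) s"
  shows "solves_uniformized k (of_real ((1 - s) * k)) (M - of_real (s * k * (real k - 1))) (\<lambda>t. p t * w t)"
    and "deriv (\<lambda>t. p t * w t) 0 = deriv w 0"
proof -
  obtain w1 w2 where d: "\<And>t. norm t < 1 \<Longrightarrow> (w has_field_derivative w1 t) (at t)"
      "\<And>t. norm t < 1 \<Longrightarrow> (w1 has_field_derivative w2 t) (at t)"
    and ode: "\<And>t. norm t < 1 \<Longrightarrow> (1 - t ^ k) * w2 t = t ^ (k - 2) * (of_real ((1 + s) * k) * t * w1 t + M * w t)"
    using w unfolding solves_uniformized_def by metis
  obtain m where m: "k = m + 2" using k nat_le_iff_add by auto
  \<comment> \<open>\<open>e\<close> is the logarithmic derivative of \<open>p\<close> and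
    \<open>e1\<close> the derivative of \<open>e\<close>, whence (p w)'' = p (w'' + 2 e w' + (e^2 +
    e1) w).\<close>
  define e :: "complex \<Rightarrow> complex" where "e = (\<lambda>t. - (of_real s * of_nat k * t ^ (m + 1) / (1 - t ^ k)))"
  define e1 :: "complex \<Rightarrow> complex" where "e1 = (\<lambda>t. - (of_real s * of_nat k * (of_nat (m + 1) * t ^ m / (1 - t ^ k)
      + of_nat k * t ^ (m + 1) * t ^ (m + 1) / (1 - t ^ k) ^ 2)))"
  have nz: "1 - t ^ k \<noteq> 0" "1 - t ^ k \<notin> \<real>\<^sub>\<le>\<^sub>0" if "norm t < 1" for t :: complex
    using one_minus_in_slit_plane[of "t ^ k"] norm_power_less_1[OF that, of k] k by auto
  have km: "k - Suc 0 = m + 1" using m by simp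
  have pw: "((\<lambda>t. 1 - t ^ k) has_field_derivative - (of_nat k * t ^ (m + 1))) (at t)" for t :: complex
    by (rule derivative_eq_intros refl)+ (simp add: m)
  have dp: "(p has_field_derivative p t * e t) (at t)" if "norm t < 1" for t
    unfolding p_def zpow_def e_def
    by (rule derivative_eq_intros pw nz[OF that] refl)+ (use nz[OF that] in \<open>simp add: field_simps\<close>)
  have de: "(e has_field_derivative e1 t) (at t)" if "norm t < 1" for t
    unfolding e_def e1_def
    by (rule derivative_eq_intros pw nz[OF that] refl)+
      (use nz[OF that] in \<open>simp add: km divide_simps power2_eq_square\<close>, simp add: algebra_simps)
  define W1 where "W1 = (\<lambda>t. p t * (w1 t + e t * w t))"
  define W2 where "W2 = (\<lambda>t. p t * (w2 t + 2 * e t * w1 t + (e t ^ 2 + e1 t) * w t))"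
  have D1: "((\<lambda>t. p t * w t) has_field_derivative W1 t) (at t)" if "norm t < 1" for t
    unfolding W1_def using dp[OF that] d(1)[OF that]
    by (auto intro!: derivative_eq_intros simp: algebra_simps)
  have D2: "(W1 has_field_derivative W2 t) (at t)" if "norm t < 1" for t
    unfolding W1_def W2_def using dp[OF that] d[OF that] de[OF that]
    by (auto intro!: derivative_eq_intros simp: algebra_simps power2_eq_square)
  \<comment> \<open>For c = 1 - 1/k the first coefficient 1 + k (a + b) equals k (1 - mu1). Passing
    from 1 + s to 1 - s is therefore the change of sign of mu1.\<close>
  have eq: "(1 - t ^ k) * W2 t = t ^ (k - 2) * (of_real ((1 - s) * k) * t * W1 t
      + (M - of_real (s * k * (real k - 1))) * (p t * w t))" if "norm t < 1" for t
  proof -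
    define r where "r = 1 / (1 - t ^ k)"
    define q where "q = t ^ m"
    define S K where "S = complex_of_real s" and "K = complex_of_nat k"
    have r: "(1 - q * t * t) * r = 1" using nz(1)[OF that] by (simp add: q_def r_def m mult_ac)
    have e: "e t = - (S * K * (q * t) * r)" by (simp add: q_def e_def r_def S_def K_def mult.commute)
    have e1: "e1 t = - (S * K * ((K - 1) * q * r + K * (q * t) * (q * t) * r\<^sup>2))"
      by (simp add: q_def e1_def r_def S_def K_def m power_divide mult.commute)
    have o: "(1 - q * t * t) * w2 t = q * ((1 + S) * K * t * w1 t + M * w t)"
      using ode[OF that] by (simp add: q_def m S_def K_def mult_ac)
    have "(1 - q * t * t) * (w2 t + 2 * e t * w1 t + (e t ^ 2 + e1 t) * w t)
      = q * ((1 - S) * K * t * (w1 t + e t * w t) + (M - S * K * (K - 1)) * w t)"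
      unfolding e e1 using o r by algebra
    then have "(1 - t ^ k) * (w2 t + 2 * e t * w1 t + (e t ^ 2 + e1 t) * w t)
      = t ^ (k - 2) * ((1 - S) * K * t * (w1 t + e t * w t) + (M - S * K * (K - 1)) * w t)"
      by (simp add: q_def m mult_ac)
    then have "p t * ((1 - t ^ k) * (w2 t + 2 * e t * w1 t + (e t ^ 2 + e1 t) * w t))
      = p t * (t ^ (k - 2) * ((1 - S) * K * t * (w1 t + e t * w t) + (M - S * K * (K - 1)) * w t))"
      by simp
    then show ?thesis by (simp add: W1_def W2_def S_def K_def algebra_simps)
  qed
  show "solves_uniformized k (of_real ((1 - s) * k)) (M - of_real (s * k * (real k - 1))) (\<lambda>t. p t * w t)"
    unfolding solves_uniformized_def using D1 D2 eq by blast
  have "e 0 = 0" "p 0 = 1" using k by (simp_all add: e_def p_def zpow_def power_0_left)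
  then show "deriv (\<lambda>t. p t * w t) 0 = deriv w 0"
    using DERIV_imp_deriv[OF D1, of 0] DERIV_imp_deriv[OF d(1), of 0] by (simp add: W1_def)
qed

section \<open>Binary forms\<close>

text \<open>Unlike \<open>homogeneous\<close>, this admits the zero form.\<close>

definition form_of_degree :: "nat \<Rightarrow> bipoly \<Rightarrow> bool" where
  "form_of_degree d P \<longleftrightarrow> (\<forall>i j. coeff (coeff P j) i \<noteq> 0 \<longrightarrow> i + j = d)"

lemma eval2_altdef:
  "eval2 P x y = (\<Sum>j\<le>degree P. \<Sum>i\<le>degree (coeff P j). coeff (coeff P j) i * x ^ i * y ^ j)"
proof -
  have "eval2 P x y = (\<Sum>j\<le>degree P. poly (coeff P j) x * y ^ j)"
    unfolding eval2_def poly_altdef[of P] by (simp add: poly_sum poly_power)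
  then show ?thesis unfolding poly_altdef[of "coeff P _"] by (simp add: sum_distrib_right)
qed

lemma eval2_form_scale:
  assumes "form_of_degree d P"
  shows "eval2 P (s * x) (s * y) = s ^ d * eval2 P x y"
proof -
  have "coeff (coeff P j) i * (s * x) ^ i * (s * y) ^ j = s ^ d * (coeff (coeff P j) i * x ^ i * y ^ j)" for i j
  proof (cases "coeff (coeff P j) i = 0")
    case False
    then have "d = i + j" using assms by (auto simp: form_of_degree_def)
    then show ?thesis by (simp add: power_mult_distrib power_add)
  qed simp
  then show ?thesis unfolding eval2_altdef sum_distrib_left by (intro sum.cong refl)
qed

lemma holomorphic_on_eval2 [holomorphic_intros]:
  assumes "u holomorphic_on A" "v holomorphic_on A"
  shows "(\<lambda>t. eval2 P (u t) (v t)) holomorphic_on A"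
  unfolding eval2_altdef by (intro holomorphic_intros assms)

lemma zpow_add: "zpow l (s + s') = zpow l s * zpow l s'"
  by (simp add: zpow_def distrib_right exp_add)

lemma zpow_power: "zpow l s ^ n = zpow l (real n * s)"
  by (simp add: zpow_def exp_of_nat_mult [symmetric] mult.assoc)

lemma zpow_0 [simp]: "zpow l 0 = 1"
  by (simp add: zpow_def)

lemma zpow_nonzero [simp]: "zpow l s \<noteq> 0"
  by (simp add: zpow_def)

lemma zpow_1 [simp]: "zpow l 1 = exp l"
  by (simp add: zpow_def)

lemma holomorphic_on_zpow [holomorphic_intros]:
  "l holomorphic_on A \<Longrightarrow> (\<lambda>t. zpow (l t) s) holomorphic_on A"
  unfolding zpow_def by (intro holomorphic_intros)

text \<open>In all four patterns the product of the three signs is positive. The signs of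
  \<open>m0\<close> and \<open>m1\<close> thus select the pattern, and exactly one sign of
  \<open>m\<close> fits it.\<close>

lemma ex1_sign_pattern:
  assumes "m0 \<noteq> 0" "m1 \<noteq> 0" "m \<noteq> (0::real)"
  shows "\<exists>!s. sign_pattern s m0 m1 m \<or> sign_pattern s m0 m1 (- m)"
proof -
  define s0 where "s0 = (if m0 > 0 then if m1 > 0 then Case_i else Case_ii
    else if m1 > 0 then Case_iii else Case_iv)"
  show ?thesis
  proof (rule ex1I[of _ s0])
    show "sign_pattern s0 m0 m1 m \<or> sign_pattern s0 m0 m1 (- m)" using assms by (auto simp: s0_def)
    fix s assume "sign_pattern s m0 m1 m \<or> sign_pattern s m0 m1 (- m)"
    then show "s = s0" by (cases s) (auto simp: s0_def)
  qed
qed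



section \<open>Klein's identities and the inverse of the Schwarz map\<close>

text \<open>
  \<open>f\<close>, \<open>g\<close>, \<open>h\<close> are the dehomogenizations of \<open>P\<^sub>\<infinity>\<close>, \<open>P\<^sub>0\<close>, \<open>P\<^sub>1\<close>. Besides the syzygy, the two facts of
  Klein's theory that are needed are that the Jacobian of \<open>P\<^sub>0\<close>, \<open>P\<^sub>\<infinity>\<close> and the Hessian of \<open>P\<^sub>\<infinity>\<close> are
  products of powers of the three forms.
\<close>

locale klein_forms =
  fixes k0 k1 kinf N :: nat and P0 P1 Pinf :: bipoly and f1 f2 g1 h1 :: "complex \<Rightarrow> complex"
  assumes k0: "k0 \<ge> 2" and k1: "k1 \<ge> 2" and kinf: "kinf \<ge> 2" and Npos: "N > 0"
    and order: "2 / real N = 1 / real k0 + 1 / real k1 + 1 / real kinf - 1"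
    and dvd: "k0 dvd N" "k1 dvd N" "kinf dvd N"
    and forms: "form_of_degree (N div k0) P0" "form_of_degree (N div k1) P1" "form_of_degree (N div kinf) Pinf"
    and init: "eval2 Pinf 1 0 = 1" "eval2 P0 1 0 = 0" "eval2 P1 1 0 = 1" "f1 0 = 0"
    and derivs: "\<And>z. (eval2 Pinf 1 has_field_derivative f1 z) (at z)"
      "\<And>z. (f1 has_field_derivative f2 z) (at z)"
      "\<And>z. (eval2 P0 1 has_field_derivative g1 z) (at z)"
      "\<And>z. (eval2 P1 1 has_field_derivative h1 z) (at z)"
    and syzygy: "\<And>z. eval2 P0 1 z ^ k0 + eval2 P1 1 z ^ k1 = eval2 Pinf 1 z ^ kinf"
    and jacobian: "\<And>z. of_nat k0 * g1 z * eval2 Pinf 1 z - of_nat kinf * eval2 P0 1 z * f1 z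
      = of_nat k0 * eval2 P1 1 z ^ (k1 - 1)"
    and hessian: "\<And>z. of_nat kinf ^ 2 * (of_nat (N div kinf) * eval2 Pinf 1 z * f2 z
        - (of_nat (N div kinf) - 1) * f1 z ^ 2)
      = (of_nat (N div kinf) - 1) * of_nat k0 ^ 2 * eval2 P0 1 z ^ (k0 - 2) * eval2 P1 1 z ^ (k1 - 2)"
begin

abbreviation "f \<equiv> eval2 Pinf 1"
abbreviation "g \<equiv> eval2 P0 1"
abbreviation "h \<equiv> eval2 P1 1"

text \<open>\<open>q\<close> is the branch of f^(-kinf/k0) and \<open>\<phi>\<close> that of f^(1/d)
  with value 1 at 0. P0 and Pinf^(kinf/k0) have the same degree N/k0, so \<open>\<tau>\<close> has
  degree 0 and depends on z = v/u alone.\<close>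

definition q where "q z = zpow (Ln (f z)) (- (real kinf / real k0))"
definition \<phi> where "\<phi> z = zpow (Ln (f z)) (real kinf / real N)"
definition \<tau> where "\<tau> z = g z * q z"

text \<open>The coefficients 1 + k0 (a + b) and k0^2 a b of the uniformized equation for case (i),
  where a = 1/kinf - 1/N and b = -1/N.\<close>

definition A :: complex where "A = of_real ((1 - 1 / real k1) * k0)"
definition M :: complex where "M = - of_real ((real (N div kinf) - 1) * real k0 ^ 2 / real N ^ 2)"

text \<open>The first condition keeps \<open>Ln (f z)\<close> holomorphic, the second allows
  cancelling powers of \<open>h z\<close> in \<open>jacobian'\<close>, the third puts
  \<open>\<tau> z\<close> where solutions are defined.\<close>

definition good :: "complex \<Rightarrow> bool" where
  "good z \<longleftrightarrow> Re (f z) > 0 \<and> h z \<noteq> 0 \<and> norm (\<tau> z) < 1"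

lemma continuous_fgh: "isCont f z" "isCont g z" "isCont h z" "isCont f1 z"
  using derivs DERIV_isCont by blast+

lemma q_\<phi>_0 [simp]: "q 0 = 1" "\<phi> 0 = 1" "\<tau> 0 = 0"
  using init by (simp_all add: q_def \<phi>_def \<tau>_def zpow_def)

lemma g1_0: "g1 0 = 1"
  using jacobian[of 0] init k0 by simp

lemma f_pos:
  assumes "Re (f z) > 0"
  shows "f z \<noteq> 0" "f z \<notin> \<real>\<^sub>\<le>\<^sub>0"
  using assms by (auto simp: complex_nonpos_Reals_iff)

lemma q_\<phi>_derivs:
  assumes "Re (f z) > 0"
  shows "(q has_field_derivative - (of_nat kinf / of_nat k0) * q z * f1 z / f z) (at z)"
    and "(\<phi> has_field_derivative (of_nat kinf / of_nat N) * \<phi> z * f1 z / f z) (at z)"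
  unfolding q_def \<phi>_def zpow_def
  using f_pos[OF assms] k0 Npos
  by (auto intro!: derivative_eq_intros derivs simp: field_simps)

text \<open>The logarithmic derivative of g / f^(kinf/k0) has the Jacobian of P0, Pinf as numerator.
  In particular \<open>\<tau>\<close> is locally injective wherever \<open>h\<close> does not
  vanish.\<close>

lemma \<tau>_deriv:
  assumes "Re (f z) > 0"
  shows "(\<tau> has_field_derivative q z * h z ^ (k1 - 1) / f z) (at z)"
proof -
  have "(\<tau> has_field_derivative g1 z * q z + - (of_nat kinf / of_nat k0) * q z * f1 z / f z * g z) (at z)"
    unfolding \<tau>_def by (rule DERIV_mult derivs q_\<phi>_derivs assms)+
  moreover have *: "h z ^ (k1 - 1) = (of_nat k0 * g1 z * f z - of_nat kinf * g z * f1 z) / of_nat k0"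
    unfolding jacobian using k0 by simp
  have "g1 z * q z + - (of_nat kinf / of_nat k0) * q z * f1 z / f z * g z = q z * h z ^ (k1 - 1) / f z"
    unfolding * using f_pos[OF assms] k0 by (simp add: field_simps)
  ultimately show ?thesis by simp
qed

text \<open>The k0-th power removes the choice of branch in \<open>q\<close>; the syzygy then
  identifies 1 - x.\<close>

lemma \<tau>_power:
  assumes "Re (f z) > 0"
  shows "\<tau> z ^ k0 = g z ^ k0 / f z ^ kinf" "1 - \<tau> z ^ k0 = h z ^ k1 / f z ^ kinf"
proof -
  have "q z ^ k0 = zpow (Ln (f z)) (- real kinf)"
    using k0 by (simp add: q_def zpow_power)
  also have "\<dots> * f z ^ kinf = 1"
  proof -
    have "f z ^ kinf = zpow (Ln (f z)) (real kinf)"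
      using zpow_power[of "Ln (f z)" 1 kinf] f_pos[OF assms] by simp
    then show ?thesis using zpow_add[of "Ln (f z)" "- real kinf" "real kinf"] by simp
  qed
  finally have "q z ^ k0 = 1 / f z ^ kinf" using f_pos[OF assms] by (simp add: field_simps)
  then show *: "\<tau> z ^ k0 = g z ^ k0 / f z ^ kinf" by (simp add: \<tau>_def power_mult_distrib)
  show "1 - \<tau> z ^ k0 = h z ^ k1 / f z ^ kinf"
    unfolding * using syzygy[of z] f_pos[OF assms] by (simp add: field_simps)
qed

text \<open>The third Jacobian follows from the syzygy by elimination.\<close>

lemma jacobian':
  assumes "h z \<noteq> 0"
  shows "of_nat k1 * h1 z * f z = of_nat kinf * f1 z * h z - of_nat k0 * g z ^ (k0 - 1)"
proof -
  obtain m0 m1 where m: "k0 = m0 + 2" "k1 = m1 + 2" using k0 k1 nat_le_iff_add by (metis add.commute)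
  obtain mi where mi: "kinf = mi + 1" using kinf by (cases kinf) auto
  have "((\<lambda>z. g z ^ k0 + h z ^ k1) has_field_derivative
      of_nat k0 * g1 z * g z ^ (k0 - 1) + of_nat k1 * h1 z * h z ^ (k1 - 1)) (at z)"
    by (auto intro!: derivative_eq_intros derivs)
  moreover have "((\<lambda>z. g z ^ k0 + h z ^ k1) has_field_derivative of_nat kinf * f1 z * f z ^ (kinf - 1)) (at z)"
    unfolding syzygy by (auto intro!: derivative_eq_intros derivs)
  ultimately have "of_nat k0 * g1 z * g z ^ (k0 - 1) + of_nat k1 * h1 z * h z ^ (k1 - 1)
      = of_nat kinf * f1 z * f z ^ (kinf - 1)"
    by (rule DERIV_unique)
  then have 1: "of_nat k0 * g1 z * (g z ^ m0 * g z) + of_nat k1 * h1 z * (h z ^ m1 * h z)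
      = of_nat kinf * f1 z * f z ^ mi"
    by (simp add: m mi mult_ac)
  have 2: "g z ^ m0 * g z * g z + h z ^ m1 * h z * h z = f z ^ mi * f z"
    using syzygy[of z] by (simp add: m mi mult_ac)
  have 3: "of_nat k0 * g1 z * f z - of_nat kinf * g z * f1 z = of_nat k0 * (h z ^ m1 * h z)"
    using jacobian[of z] by (simp add: m mult_ac)
  define gm hm fm K0 K1 Ki where "gm = g z ^ m0" and "hm = h z ^ m1" and "fm = f z ^ mi"
    and "K0 = (of_nat k0 :: complex)" and "K1 = (of_nat k1 :: complex)" and "Ki = (of_nat kinf :: complex)"
  note eqs = 1 2 3
  \<comment> \<open>Multiply the differentiated syzygy by f, remove g1 by the given Jacobian and
    f^kinf by the syzygy: what remains has the common factor h^(k1 - 1).\<close>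
  have "(hm * h z) * (K1 * h1 z * f z) = (hm * h z) * (Ki * f1 z * h z - K0 * (gm * g z))"
    using eqs unfolding gm_def[symmetric] hm_def[symmetric] fm_def[symmetric]
      K0_def[symmetric] K1_def[symmetric] Ki_def[symmetric] by algebra
  moreover have "hm * h z \<noteq> 0" using assms by (simp add: hm_def)
  ultimately show ?thesis
    by (simp add: gm_def K0_def K1_def Ki_def m mult_ac)
qed

text \<open>The second derivative of \<open>w (\<tau> z) * \<phi> z\<close> turns out to be
  \<phi>/f^2 times q h^(k1 - 2) Q w'(\<tau>) + R w(\<tau>), and both \<open>Q\<close> and
  \<open>R\<close> vanish. The value and slope at 0 come from q = \<phi> = f = h = 1 and f1 = 0
  there.\<close>

lemma solution_eq_linear:
  assumes w: "solves_uniformized k0 A M w" and r: "r > 0" "\<And>z. z \<in> ball 0 r \<Longrightarrow> good z" and z: "z \<in> ball 0 r"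
  shows "w (\<tau> z) * \<phi> z = w 0 + deriv w 0 * z"
proof -
  obtain w1 w2 where dw: "\<And>t. norm t < 1 \<Longrightarrow> (w has_field_derivative w1 t) (at t)"
      "\<And>t. norm t < 1 \<Longrightarrow> (w1 has_field_derivative w2 t) (at t)"
    and ode: "\<And>t. norm t < 1 \<Longrightarrow> (1 - t ^ k0) * w2 t = t ^ (k0 - 2) * (A * t * w1 t + M * w t)"
    using w unfolding solves_uniformized_def by metis
  obtain m0 m1 where m: "k0 = m0 + 2" "k1 = m1 + 2" using k0 k1 nat_le_iff_add by (metis add.commute)
  define \<Phi>1 where "\<Phi>1 = (\<lambda>z. w1 (\<tau> z) * (q z * h z ^ (m1 + 1) * \<phi> z / f z)
      + w (\<tau> z) * ((of_nat kinf / of_nat N) * \<phi> z * f1 z / f z))"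
  define d where "d = N div kinf"
  have Nd: "N = d * kinf" using dvd(3) by (simp add: d_def)
  have cnz: "of_nat k0 \<noteq> (0::complex)" "of_nat k1 \<noteq> (0::complex)" "of_nat kinf \<noteq> (0::complex)"
    "of_nat N \<noteq> (0::complex)" "of_nat d \<noteq> (0::complex)"
    using k0 k1 kinf Npos Nd by auto
  have D\<Phi>: "((\<lambda>z. w (\<tau> z) * \<phi> z) has_field_derivative \<Phi>1 z) (at z)" if "z \<in> ball 0 r" for z
  proof -
    have gz: "Re (f z) > 0" "norm (\<tau> z) < 1" using r(2)[OF that] by (auto simp: good_def)
    note rules = DERIV_chain2[where f = w, OF dw(1)[OF gz(2)] \<tau>_deriv[OF gz(1)]] q_\<phi>_derivs[OF gz(1)]
    show ?thesis unfolding \<Phi>1_def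
      by (rule derivative_eq_intros rules refl)+ (simp add: m algebra_simps)
  qed
  have D\<Phi>1: "(\<Phi>1 has_field_derivative 0) (at z)" if "z \<in> ball 0 r" for z
  proof -
    have gz: "Re (f z) > 0" "norm (\<tau> z) < 1" "h z \<noteq> 0" using r(2)[OF that] by (auto simp: good_def)
    have fnz: "f z \<noteq> 0" using f_pos[OF gz(1)] by simp
    define t1 where "t1 = q z * h z ^ (m1 + 1) / f z"
    define e where "e = (of_nat kinf / of_nat N :: complex)"
    define e0 where "e0 = (of_nat kinf / of_nat k0 :: complex)"
    note rules = DERIV_chain2[where f = w, OF dw(1)[OF gz(2)] \<tau>_deriv[OF gz(1)]]
      DERIV_chain2[where f = w1, OF dw(2)[OF gz(2)] \<tau>_deriv[OF gz(1)]] q_\<phi>_derivs[OF gz(1)] derivs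
    \<comment> \<open>The factor q \<phi> / f is the power f^(e - e0 - 1), which explains the last
      coefficient.\<close>
    have E: "((\<lambda>z. q z * h z ^ (m1 + 1) * \<phi> z / f z) has_field_derivative
        q z * \<phi> z * h z ^ m1 / f z ^ 2 * (of_nat (m1 + 1) * h1 z * f z + h z * f1 z * (e - e0 - 1))) (at z)"
      by (rule derivative_eq_intros rules refl fnz)+
        (use fnz in \<open>simp add: e_def[symmetric] e0_def[symmetric] field_simps power2_eq_square\<close>)
    have E': "((\<lambda>z. (of_nat kinf / of_nat N) * \<phi> z * f1 z / f z) has_field_derivative
        \<phi> z / f z ^ 2 * (e ^ 2 * f1 z ^ 2 + e * f2 z * f z - e * f1 z ^ 2)) (at z)"
      by (rule derivative_eq_intros rules refl fnz)+
        (use fnz in \<open>simp add: e_def[symmetric] e0_def[symmetric] field_simps power2_eq_square\<close>)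
    have DD: "(\<Phi>1 has_field_derivative
        w2 (\<tau> z) * t1 * (q z * h z ^ (m1 + 1) * \<phi> z / f z)
        + w1 (\<tau> z) * (q z * \<phi> z * h z ^ m1 / f z ^ 2 * (of_nat (m1 + 1) * h1 z * f z + h z * f1 z * (e - e0 - 1)))
        + w1 (\<tau> z) * t1 * (e * \<phi> z * f1 z / f z)
        + w (\<tau> z) * (\<phi> z / f z ^ 2 * (e ^ 2 * f1 z ^ 2 + e * f2 z * f z - e * f1 z ^ 2))) (at z)"
      unfolding \<Phi>1_def
      by (rule derivative_eq_intros rules refl E E')+
        (simp add: m t1_def e_def[symmetric] algebra_simps)
    have W2: "w2 (\<tau> z) * t1 * (q z * h z ^ (m1 + 1) * \<phi> z / f z)
        = \<phi> z / f z ^ 2 * h z ^ m1 * g z ^ m0 * (A * (g z * q z) * w1 (\<tau> z) + M * w (\<tau> z))"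
    proof -
      have \<tau>: "A * \<tau> z * w1 (\<tau> z) = A * (g z * q z) * w1 (\<tau> z)" "\<tau> z ^ (k0 - 2) = (g z * q z) ^ m0"
        using arg_cong[OF m(1), of "\<lambda>k. k - 2"] by (simp_all add: \<tau>_def)
      have "h z ^ k1 / f z ^ kinf * w2 (\<tau> z) = (g z * q z) ^ m0 * (A * (g z * q z) * w1 (\<tau> z) + M * w (\<tau> z))"
        using ode[OF gz(2)] unfolding \<tau>_power(2)[OF gz(1)] \<tau> .
      then have *: "h z ^ k1 * w2 (\<tau> z)
          = f z ^ kinf * ((g z * q z) ^ m0 * (A * (g z * q z) * w1 (\<tau> z) + M * w (\<tau> z)))"
        using fnz by (simp add: field_simps)
      \<comment> \<open>At zeros of g, such as z = 0, this cannot be read off from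
        \<open>\<tau>_power\<close> by cancelling g^k0.\<close>
      have qf: "q z ^ k0 * f z ^ kinf = 1"
      proof (cases "g z = 0")
        case False
        then show ?thesis using \<tau>_power(1)[OF gz(1)] fnz by (simp add: \<tau>_def power_mult_distrib field_simps)
      qed (use fnz f_pos[OF gz(1)] zpow_add[of "Ln (f z)" "- real kinf" "real kinf"]
          zpow_power[of "Ln (f z)" 1 kinf] k0 in \<open>simp add: q_def zpow_power\<close>)
      \<comment> \<open>Differentiating twice along \<open>\<tau>\<close> supplies q^2, which
        completes the q^(k0 - 2) of the equation to q^k0, and this cancels f^kinf.\<close>
      have "w2 (\<tau> z) * t1 * (q z * h z ^ (m1 + 1) * \<phi> z / f z)
          = \<phi> z / f z ^ 2 * h z ^ m1 * (q z ^ 2 * (h z ^ k1 * w2 (\<tau> z)))"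
        by (simp add: t1_def m power2_eq_square)
      also have "\<dots> = \<phi> z / f z ^ 2 * h z ^ m1 * ((q z ^ k0 * f z ^ kinf)
          * (g z ^ m0 * (A * (g z * q z) * w1 (\<tau> z) + M * w (\<tau> z))))"
        unfolding * by (simp add: m power_mult_distrib power2_eq_square mult_ac)
      finally show ?thesis unfolding qf by simp
    qed
    define Q where "Q = (A * (g z ^ m0 * g z) + of_nat (m1 + 1) * h1 z * f z + h z * f1 z * (2 * e - e0 - 1))"
    define R where "R = (M * h z ^ m1 * g z ^ m0 + e ^ 2 * f1 z ^ 2 + e * f2 z * f z - e * f1 z ^ 2)"
    \<comment> \<open>Eliminate g^(k0 - 1) by the third Jacobian: the terms h1 f cancel, and the
      coefficient of h f1 vanishes by the order relation multiplied by kinf.\<close>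
    have "Q = 0"
    proof -
      define K0 K1 Ki i1 where "K0 = (of_nat k0 :: complex)" and "K1 = (of_nat k1 :: complex)"
        and "Ki = (of_nat kinf :: complex)" and "i1 = (1 / of_nat k1 :: complex)"
      have J: "K1 * h1 z * f z = Ki * f1 z * h z - K0 * (g z ^ m0 * g z)"
        using jacobian'[OF gz(3)] unfolding K1_def Ki_def K0_def by (simp add: m mult_ac)
      have i1: "i1 * K1 = 1" using cnz by (simp add: i1_def K1_def)
      have "2 * real kinf / real N = kinf / real k0 + kinf / real k1 + 1 - kinf"
        using arg_cong[OF order, of "\<lambda>x. x * real kinf"] kinf by (simp add: ring_distribs)
      then have "complex_of_real (2 * real kinf / real N) = of_real (kinf / real k0 + kinf / real k1 + 1 - kinf)"
        by (simp only:)
      then have o: "2 * e = e0 + Ki * i1 + 1 - Ki"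
        by (simp add: e_def e0_def Ki_def i1_def)
      have A: "A = K0 * (1 - i1)" by (simp add: A_def K0_def i1_def)
      have M1: "of_nat (m1 + 1) = K1 - 1" by (simp add: K1_def m)
      define G where "G = g z ^ m0 * g z"
      show ?thesis using J o i1 unfolding Q_def A M1 G_def[symmetric] by algebra
    qed
    moreover have "R = 0"
    proof -
      \<comment> \<open>Since e d = 1, the multiple N^2 R is precisely the difference of the two
        sides of the Hessian relation.\<close>
      have H: "of_nat kinf ^ 2 * (of_nat d * f z * f2 z - (of_nat d - 1) * f1 z ^ 2)
        = (of_nat d - 1) * of_nat k0 ^ 2 * (g z ^ m0 * h z ^ m1)"
        using hessian[of z] by (simp add: d_def m mult.assoc)
      have M: "M * of_nat N ^ 2 = - ((of_nat d - 1) * of_nat k0 ^ 2)"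
        using Npos by (simp add: M_def d_def)
      have eN: "e * of_nat N = of_nat kinf" "e * of_nat d = 1"
        using cnz by (simp_all add: e_def Nd)
      have "of_nat N ^ 2 * R = (M * of_nat N ^ 2) * (g z ^ m0 * h z ^ m1) + (e * of_nat N) ^ 2 * f1 z ^ 2
          + (e * of_nat N) ^ 2 * ((f2 z * f z - f1 z ^ 2) * of_nat d)"
      proof -
        have *: "e * (f2 z * f z - f1 z ^ 2) = e ^ 2 * ((f2 z * f z - f1 z ^ 2) * of_nat d)"
          using eN(2) by algebra
        have "R = M * (g z ^ m0 * h z ^ m1) + e ^ 2 * f1 z ^ 2 + e ^ 2 * ((f2 z * f z - f1 z ^ 2) * of_nat d)"
          unfolding R_def *[symmetric] by (simp add: algebra_simps)
        then show ?thesis by (simp only: ring_distribs power_mult_distrib) (simp only: mult_ac)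
      qed
      also have "\<dots> = 0"
      proof -
        define GH where "GH = g z ^ m0 * h z ^ m1"
        show ?thesis using H unfolding M eN GH_def[symmetric] by algebra
      qed
      finally show ?thesis using cnz by simp
    qed
    moreover have "w2 (\<tau> z) * t1 * (q z * h z ^ (m1 + 1) * \<phi> z / f z)
        + w1 (\<tau> z) * (q z * \<phi> z * h z ^ m1 / f z ^ 2 * (of_nat (m1 + 1) * h1 z * f z + h z * f1 z * (e - e0 - 1)))
        + w1 (\<tau> z) * t1 * (e * \<phi> z * f1 z / f z)
        + w (\<tau> z) * (\<phi> z / f z ^ 2 * (e ^ 2 * f1 z ^ 2 + e * f2 z * f z - e * f1 z ^ 2))
      = \<phi> z / f z ^ 2 * (w1 (\<tau> z) * q z * h z ^ m1 * Q + w (\<tau> z) * R)"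
      unfolding W2 unfolding Q_def R_def t1_def
      using fnz by (simp add: field_simps power2_eq_square)
    ultimately show ?thesis using DD by simp
  qed
  have "\<exists>c. \<forall>z\<in>ball 0 r. \<Phi>1 z = c"
    by (rule has_field_derivative_zero_constant) (auto intro!: DERIV_subset[OF D\<Phi>1])
  moreover have "\<Phi>1 0 = deriv w 0"
    using init DERIV_imp_deriv[OF dw(1)[of 0]] by (simp add: \<Phi>1_def)
  ultimately have \<Phi>1: "\<Phi>1 z = deriv w 0" if "z \<in> ball 0 r" for z
    using that r(1) by (metis centre_in_ball)
  have "\<exists>c. \<forall>z\<in>ball 0 r. w (\<tau> z) * \<phi> z - deriv w 0 * z = c"
  proof (rule has_field_derivative_zero_constant)
    fix z :: complex assume z: "z \<in> ball 0 r"
    show "((\<lambda>z. w (\<tau> z) * \<phi> z - deriv w 0 * z) has_field_derivative 0) (at z within ball 0 r)"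
      by (rule DERIV_cong[OF DERIV_diff[OF has_field_derivative_at_within[OF D\<Phi>[OF z]] DERIV_cmult[OF DERIV_ident]]])
        (simp add: \<Phi>1[OF z])
  qed simp
  then obtain c where c: "\<And>z. z \<in> ball 0 r \<Longrightarrow> w (\<tau> z) * \<phi> z - deriv w 0 * z = c" by auto
  from c[of 0] r(1) have "c = w 0" by simp
  with c[OF z] show ?thesis by (simp add: algebra_simps)
qed

lemma good_neighbourhood: obtains r where "r > 0" "\<And>z. z \<in> ball 0 r \<Longrightarrow> good z"
proof -
  have nhds: "(F \<longlongrightarrow> F a) (nhds a)" if "isCont F a" for F :: "complex \<Rightarrow> real" and a
    using that by (simp add: isCont_def tendsto_at_iff_tendsto_nhds)
  have "isCont (\<lambda>z. Re (f z)) 0" using continuous_fgh(1)[of 0] by (rule isCont_Re)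
  then have "\<forall>\<^sub>F z in nhds 0. 0 < Re (f z)"
    by (rule order_tendstoD[OF nhds]) (simp add: init)
  moreover have "isCont (\<lambda>z. norm (h z)) 0" using continuous_fgh(3)[of 0] by (rule isCont_norm)
  then have "\<forall>\<^sub>F z in nhds 0. 0 < norm (h z)"
    by (rule order_tendstoD[OF nhds]) (simp add: init)
  moreover have "isCont (\<lambda>z. norm (\<tau> z)) 0"
    using DERIV_isCont[OF \<tau>_deriv[of 0]] init by (intro isCont_norm) simp
  then have "\<forall>\<^sub>F z in nhds 0. norm (\<tau> z) < 1"
    by (rule order_tendstoD[OF nhds]) simp
  ultimately have "\<forall>\<^sub>F z in nhds 0. 0 < Re (f z) \<and> 0 < norm (h z) \<and> norm (\<tau> z) < 1"
    by (intro eventually_conj)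
  then have "\<forall>\<^sub>F z in nhds 0. good z" by eventually_elim (auto simp: good_def)
  then show thesis using that by (auto simp: eventually_nhds_metric mem_ball dist_commute)
qed

theorem klein_identities:
  assumes U: "solves_uniformized k0 A M U" "U 0 = 1" "deriv U 0 = 0"
    and V: "solves_uniformized k0 A M V" "V 0 = 0" "deriv V 0 = 1"
    and t: "norm t < 1"
  shows "eval2 P0 (U t) (V t) = t"
    and "eval2 P1 (U t) (V t) = zpow (Ln (1 - t ^ k0)) (1 / real k1)"
    and "eval2 Pinf (U t) (V t) = 1"
proof -
  let ?D = "ball 0 1 :: complex set"
  obtain r where r: "r > 0" "\<And>z. z \<in> ball 0 r \<Longrightarrow> good z" using good_neighbourhood by blast
  note hol = solves_uniformized_holomorphic[OF U(1)] solves_uniformized_holomorphic[OF V(1)]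
  have \<phi>_power: "\<phi> z ^ (N div k) = zpow (Ln (f z)) (real kinf / real k)" if "k dvd N" for z k
    using that Npos by (auto simp: \<phi>_def zpow_power elim!: dvdE)
  have kum: "U (\<tau> z) * \<phi> z = 1" "V (\<tau> z) * \<phi> z = z" if "z \<in> ball 0 r" for z
    using solution_eq_linear[OF U(1) r that] solution_eq_linear[OF V(1) r that] U V by simp_all
  have scale: "\<phi> z ^ (N div k) * eval2 P (U (\<tau> z)) (V (\<tau> z)) = eval2 P 1 z"
    if "z \<in> ball 0 r" "form_of_degree (N div k) P" for z P k
    using eval2_form_scale[OF that(2), of "\<phi> z" "U (\<tau> z)" "V (\<tau> z)"] kum[OF that(1)]
    by (simp add: mult.commute)
  have loc0: "eval2 P0 (U (\<tau> z)) (V (\<tau> z)) = \<tau> z" if "z \<in> ball 0 r" for z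
  proof -
    have "zpow (Ln (f z)) (real kinf / real k0) * q z = 1"
      by (simp add: q_def flip: zpow_add)
    then show ?thesis
      using scale[OF that forms(1)] \<phi>_power[OF dvd(1), of z]
      by (metis \<tau>_def mult.commute mult.left_commute mult.right_neutral)
  qed
  have locinf: "eval2 Pinf (U (\<tau> z)) (V (\<tau> z)) = 1" if "z \<in> ball 0 r" for z
  proof -
    have "f z \<noteq> 0" using r(2)[OF that] f_pos by (auto simp: good_def)
    then show ?thesis
      using scale[OF that forms(3)] \<phi>_power[OF dvd(3), of z] kinf by simp
  qed
  \<comment> \<open>Only the k1-th power is accessible here, since the branch of the root of 1 - x
    is not yet known.\<close>
  have loc1: "eval2 P1 (U (\<tau> z)) (V (\<tau> z)) ^ k1 = 1 - \<tau> z ^ k0" if "z \<in> ball 0 r" for z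
  proof -
    have fz: "Re (f z) > 0" "f z \<noteq> 0" using r(2)[OF that] f_pos by (auto simp: good_def)
    have "f z ^ kinf = (zpow (Ln (f z)) (real kinf / real k1)) ^ k1"
      using k1 zpow_power[of "Ln (f z)" 1 kinf] fz by (simp add: zpow_power)
    then have "f z ^ kinf * eval2 P1 (U (\<tau> z)) (V (\<tau> z)) ^ k1 = h z ^ k1"
      using scale[OF that forms(2)] \<phi>_power[OF dvd(2), of z] by (metis power_mult_distrib)
    then show ?thesis unfolding \<tau>_power(2)[OF fz(1)] using fz(2) by (simp add: field_simps)
  qed
  text \<open>The relations hold on the open image of \<open>\<tau>\<close>, hence on the whole disc.\<close>
  have \<tau>_hol: "\<tau> holomorphic_on ball 0 r"
    using \<tau>_deriv r(2) unfolding holomorphic_on_open[OF open_ball] good_def by blast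
  have "\<not> \<tau> constant_on ball 0 r"
  proof
    assume "\<tau> constant_on ball 0 r"
    then have "\<tau> z = \<tau> 0" if "z \<in> ball 0 r" for z
      using that r(1) by (metis centre_in_ball constant_on_def)
    moreover have "\<forall>\<^sub>F z in nhds 0. z \<in> ball 0 r"
      using r(1) by (intro eventually_nhds_in_open) auto
    ultimately have "\<forall>\<^sub>F z in nhds 0. \<tau> z = \<tau> 0"
      by (auto elim: eventually_mono)
    then have "deriv \<tau> 0 = deriv (\<lambda>_. \<tau> 0) 0" by (rule deriv_cong_ev) simp
    moreover have "deriv \<tau> 0 = 1" using DERIV_imp_deriv[OF \<tau>_deriv[of 0]] init by simp
    ultimately show False by simp
  qed
  then have img: "open (\<tau> ` ball 0 r)"
    using open_mapping_thm[OF \<tau>_hol] by blast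
  have img': "\<tau> ` ball 0 r \<noteq> {}" "\<tau> ` ball 0 r \<subseteq> ?D" using r by (auto simp: good_def)
  have ext: "F t = G t"
    if "F holomorphic_on ?D" "G holomorphic_on ?D" "\<And>z. z \<in> ball 0 r \<Longrightarrow> F (\<tau> z) = G (\<tau> z)" "t \<in> ?D" for F G t
    by (rule analytic_continuation_open[OF img _ img'(1) _ img'(2) that(1,2)]) (use that in auto)
  show "eval2 P0 (U t) (V t) = t"
    by (rule ext[of "\<lambda>t. eval2 P0 (U t) (V t)" "\<lambda>t. t"]) (use t in \<open>auto intro!: holomorphic_intros hol loc0\<close>)
  show "eval2 Pinf (U t) (V t) = 1"
    by (rule ext[of "\<lambda>t. eval2 Pinf (U t) (V t)" "\<lambda>t. 1"]) (use t in \<open>auto intro!: holomorphic_intros hol locinf\<close>)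
  \<comment> \<open>\<open>R\<close> and \<open>S\<close> have equal k1-th powers and
    \<open>S\<close> has no zero, so R/S maps the connected disc into the finite set of k1-th roots
    of unity. It is constant, with value 1 at t = 0.\<close>
  define R where "R = (\<lambda>t. eval2 P1 (U t) (V t))"
  define S where "S = (\<lambda>t. zpow (Ln (1 - t ^ k0)) (1 / real k1))"
  have slit: "1 - t ^ k0 \<notin> \<real>\<^sub>\<le>\<^sub>0" "1 - t ^ k0 \<noteq> 0" if "t \<in> ?D" for t
    using one_minus_in_slit_plane[of "t ^ k0"] norm_power_less_1[of t k0] that k0 by auto
  have R_hol: "R holomorphic_on ?D" unfolding R_def by (intro holomorphic_intros hol)
  have S_hol: "S holomorphic_on ?D" unfolding S_def using slit by (intro holomorphic_intros) auto
  have Rk: "R t ^ k1 = 1 - t ^ k0" if "t \<in> ?D" for t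
    by (rule ext[of "\<lambda>t. R t ^ k1"])
      (use that in \<open>auto intro!: holomorphic_intros R_hol simp: loc1 R_def[symmetric] simp del: mem_ball\<close>, simp add: R_def loc1)
  have Sk: "S t ^ k1 = 1 - t ^ k0" if "t \<in> ?D" for t
    using slit[OF that] k1 by (simp add: S_def zpow_power)
  have "connected ((\<lambda>t. R t / S t) ` ?D)"
    by (intro connected_continuous_image continuous_intros holomorphic_on_imp_continuous_on R_hol S_hol)
      (auto simp: S_def)
  moreover have "(\<lambda>t. R t / S t) ` ?D \<subseteq> {z. z ^ k1 = 1}"
    using Rk Sk slit by (auto simp: power_divide simp del: mem_ball)
  then have "finite ((\<lambda>t. R t / S t) ` ?D)"
    by (rule finite_subset) (use k1 in \<open>simp add: finite_roots_unity\<close>)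
  ultimately obtain c where "(\<lambda>t. R t / S t) ` ?D = {c}"
    by (metis centre_in_ball connected_finite_iff_sing empty_iff image_is_empty zero_less_one)
  then have c: "R t / S t = c" if "t \<in> ?D" for t using that by blast
  have "R 0 / S 0 = 1" using init U V k0 by (simp add: R_def S_def power_0_left zpow_def)
  then have "R t / S t = 1" using c[of 0] c[of t] t by simp
  then show "eval2 P1 (U t) (V t) = zpow (Ln (1 - t ^ k0)) (1 / real k1)"
    by (simp add: R_def S_def)
qed

section \<open>Nonvanishing of the forms and bounds on the orders\<close>

lemma homogeneous_forms:
  "homogeneous (N div k0) P0" "homogeneous (N div k1) P1" "homogeneous (N div kinf) Pinf"
proof -
  have "Pinf \<noteq> 0" "P1 \<noteq> 0" using init by (auto simp: eval2_def)
  moreover have "P0 \<noteq> 0"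
  proof
    assume "P0 = 0"
    then have "g = (\<lambda>_. 0)" by (auto simp: eval2_def)
    then show False using DERIV_unique[OF derivs(3)[of 0], of 0] g1_0 by simp
  qed
  ultimately show "homogeneous (N div k0) P0" "homogeneous (N div k1) P1" "homogeneous (N div kinf) Pinf"
    using forms by (simp_all add: homogeneous_def form_of_degree_def)
qed

text \<open>Two of the three reciprocals are at most 1/2, so the order relation bounds 2/N by the
  third. These bounds serve to keep the hypergeometric parameters off the nonpositive
  integers.\<close>

lemma degree_bounds: "N > k0" "N > kinf" "N > k1"
proof -
  have half: "1 / real k0 \<le> 1 / 2" "1 / real k1 \<le> 1 / 2" "1 / real kinf \<le> 1 / 2"
    using k0 k1 kinf by (simp_all add: field_simps)
  have less: "1 / real N < 1 / real k" if "2 / real N \<le> 1 / real k" for k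
  proof -
    have "0 < 1 / real N" using Npos by simp
    then show ?thesis using that by linarith
  qed
  have "2 / real N \<le> 1 / real k0" "2 / real N \<le> 1 / real k1" "2 / real N \<le> 1 / real kinf"
    using order half by linarith+
  note this[THEN less]
  then show "N > k0" "N > kinf" "N > k1"
    using Npos k0 k1 kinf by (simp_all add: field_simps)
qed

lemma inverse_bounds:
  "0 < 1 / real N" "1 / real N < 1" "1 / real N < 1 / real k0" "1 / real N < 1 / real k1"
  "1 / real N < 1 / real kinf" "0 < 1 / real k0" "0 < 1 / real k1" "1 / real k0 \<le> 1 / 2"
  using degree_bounds k0 k1 kinf Npos by (simp_all add: field_simps)

lemma N_div: "k dvd N \<Longrightarrow> real (N div k) = real N / real k"
  by (simp add: real_of_nat_div)

lemma M_eq: "M = of_real (- (real k0 ^ 2 * (1 / real N) * (1 / real kinf - 1 / real N)))"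
proof -
  have "- ((real (N div kinf) - 1) * real k0 ^ 2 / real N ^ 2)
      = - (real k0 ^ 2 * (1 / real N) * (1 / real kinf - 1 / real N))"
    unfolding N_div[OF dvd(3)] using kinf Npos by (simp add: field_simps power2_eq_square)
  then show ?thesis unfolding M_def of_real_minus[symmetric] by (rule arg_cong)
qed

lemma uniformizer:
  assumes "exp l0 = x" "norm x < 1"
  shows "zpow l0 (1 / real k0) ^ k0 = x" "norm (zpow l0 (1 / real k0)) < 1"
proof -
  show *: "zpow l0 (1 / real k0) ^ k0 = x" using assms k0 by (simp add: zpow_power)
  show "norm (zpow l0 (1 / real k0)) < 1"
    using assms(2) k0 unfolding *[symmetric] norm_power by (simp add: power_less_one_iff)
qed

section \<open>The identities near the origin in the four sign patterns\<close>

lemma identities_Case_i: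
  assumes c: "1 - c = 1 / real k0" and ab: "c - a - b = 1 / real k1" "a - b = 1 / real kinf"
    and x: "exp l0 = x" "norm x < 1"
  shows "identities Case_i (k0, k1, kinf) N (P0, P1, Pinf) l0 (Ln (1 - x)) (kummer_u a b c x) (kummer_v a b c l0 x)"
proof -
  define t where "t = zpow l0 (1 / real k0)"
  note t = uniformizer[OF x, folded t_def]
  have b: "b = - (1 / real N)" and a: "a = 1 / real kinf - 1 / real N" using c ab order by linarith+
  have nz: "a \<notin> \<int>\<^sub>\<le>\<^sub>0" "b \<notin> \<int>\<^sub>\<le>\<^sub>0" "a + 1 / real k0 \<notin> \<int>\<^sub>\<le>\<^sub>0" "b + 1 / real k0 \<notin> \<int>\<^sub>\<le>\<^sub>0"
    using inverse_bounds a b by (intro not_nonpos_Int; linarith)+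
  have "1 + k0 * (a + b) = (1 - 1 / real k1) * k0"
  proof -
    have "a + b = 1 - 1 / real k0 - 1 / real k1" using c ab by linarith
    then show ?thesis using k0 by (simp add: field_simps)
  qed
  then have A: "of_real (1 + k0 * (a + b)) = A" by (simp only: A_def)
  have M: "of_real (real k0 ^ 2 * a * b) = M" unfolding M_eq a b by (simp add: mult_ac)
  have c': "c = 1 - 1 / real k0" using c by linarith
  note U = solves_uniformized_exponent_0[OF k0 c' nz(1,2), unfolded A M]
  note V = solves_uniformized_exponent_1[OF k0 nz(3,4), unfolded A M]
  have "kummer_u a b c x = hyperF a b c (t ^ k0)"
    and "kummer_v a b c l0 x = t * hyperF (a + 1 / real k0) (b + 1 / real k0) (1 + 1 / real k0) (t ^ k0)"
    by (simp_all add: kummer_u_def kummer_v_def t c' t_def[symmetric])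
  then show ?thesis
    using klein_identities[OF U(1) _ U(2) V(1) _ V(2) t(2)] k0
    by (simp add: t(1) power_0_left) (simp add: t_def)
qed

lemma identities_Case_ii:
  assumes c: "1 - c = 1 / real k0" and ab: "c - a - b = - 1 / real k1" "a - b = - 1 / real kinf"
    and x: "exp l0 = x" "norm x < 1"
  shows "identities Case_ii (k0, k1, kinf) N (P0, P1, Pinf) l0 (Ln (1 - x)) (kummer_u a b c x) (kummer_v a b c l0 x)"
proof -
  define t where "t = zpow l0 (1 / real k0)"
  note t = uniformizer[OF x, folded t_def]
  have b: "b = 1 - 1 / real k0 + 1 / real N" and a: "a = 1 / real k1 - 1 / real N" using c ab order by linarith+
  have nz: "a \<notin> \<int>\<^sub>\<le>\<^sub>0" "b \<notin> \<int>\<^sub>\<le>\<^sub>0" "a + 1 / real k0 \<notin> \<int>\<^sub>\<le>\<^sub>0" "b + 1 / real k0 \<notin> \<int>\<^sub>\<le>\<^sub>0"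
    using inverse_bounds a b by (intro not_nonpos_Int; linarith)+
  define s where "s = 1 / real k1"
  have A': "1 + k0 * (a + b) = (1 + s) * k0"
  proof -
    have "a + b = 1 - 1 / real k0 + 1 / real k1" using c ab by linarith
    then show ?thesis using k0 by (simp add: s_def field_simps)
  qed
  have A: "of_real ((1 - s) * k0) = A" by (simp only: A_def s_def)
  \<comment> \<open>Euler's transformation replaces a, b by c - a = 1/kinf - 1/N and c - b = -1/N,
    the parameters of case (i); hence the constant is again \<open>M\<close>.\<close>
  have M: "of_real (real k0 ^ 2 * a * b) - of_real (s * k0 * (real k0 - 1)) = M"
  proof -
    define n i0 ii where "n = 1 / real N" and "i0 = 1 / real k0" and "ii = 1 / real kinf"
    have "2 * n = i0 + s + ii - 1" using order by (simp add: n_def i0_def ii_def s_def)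
    moreover have "real k0 * i0 = 1" using k0 by (simp add: i0_def)
    moreover have "a = s - n" "b = 1 - i0 + n" using a b by (simp_all add: n_def i0_def ii_def s_def)
    ultimately have "real k0 ^ 2 * a * b - s * k0 * (real k0 - 1) = - (real k0 ^ 2 * n * (ii - n))"
      by algebra
    then show ?thesis unfolding M_eq n_def ii_def of_real_diff[symmetric] by (rule arg_cong)
  qed
  have c': "c = 1 - 1 / real k0" using c by linarith
  define p where "p t = zpow (Ln (1 - t ^ k0)) s" for t
  note E = solves_uniformized_Euler[OF k0, of s, unfolded A, folded p_def]
  note U = solves_uniformized_exponent_0[OF k0 c' nz(1,2), unfolded A']
  note V = solves_uniformized_exponent_1[OF k0 nz(3,4), unfolded A']
  note U' = E[OF U(1), unfolded M] and V' = E[OF V(1), unfolded M]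
  have uv: "kummer_u a b c x = hyperF a b c (t ^ k0)"
    "kummer_v a b c l0 x = t * hyperF (a + 1 / real k0) (b + 1 / real k0) (1 + 1 / real k0) (t ^ k0)"
    by (simp_all add: kummer_u_def kummer_v_def t c' t_def[symmetric])
  have p0: "p 0 = 1" using k0 by (simp add: p_def zpow_def power_0_left)
  define u v where "u = kummer_u a b c x" and "v = kummer_v a b c l0 x"
  have K: "eval2 P0 (p t * u) (p t * v) = t"
    "eval2 P1 (p t * u) (p t * v) = zpow (Ln (1 - x)) (1 / real k1)"
    "eval2 Pinf (p t * u) (p t * v) = 1"
    using klein_identities[OF U'(1) _ _ V'(1) _ _ t(2)] p0 U(2) V(2) U'(2) V'(2) k0
    unfolding u_def v_def uv t(1) by (simp_all add: power_0_left)
  \<comment> \<open>By homogeneity P_j(p u, p v) = p^(N/k_j) P_j(u, v); moving this power of 1 - x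
    to the right gives the exponents -N/(k1 k_j).\<close>
  have inv: "E = zpow (Ln (1 - x)) (- (real N / (real k1 * real k))) * E'"
    if "k dvd N" "p t ^ (N div k) * E = E'" for E E' k
  proof -
    have "p t ^ (N div k) = zpow (Ln (1 - x)) (real N / (real k1 * real k))"
      by (simp add: p_def t(1) s_def zpow_power N_div[OF that(1)] mult.commute)
    then have "E' = zpow (Ln (1 - x)) (real N / (real k1 * real k)) * E" using that(2) by simp
    then show ?thesis by (simp flip: zpow_add mult.assoc)
  qed
  note I = inv[OF dvd(1) K(1)[unfolded eval2_form_scale[OF forms(1)]]]
    inv[OF dvd(2) K(2)[unfolded eval2_form_scale[OF forms(2)]]]
    inv[OF dvd(3) K(3)[unfolded eval2_form_scale[OF forms(3)]]]
  have "zpow (Ln (1 - x)) (1 / real k1 - real N / real k1 ^ 2)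
      = zpow (Ln (1 - x)) (- (real N / (real k1 * real k1))) * zpow (Ln (1 - x)) (1 / real k1)"
    by (simp flip: zpow_add add: power2_eq_square)
  then show ?thesis
    using I by (simp add: u_def[symmetric] v_def[symmetric] t_def[symmetric] mult.commute)
qed

text \<open>For the parameters b - c + 1, a - c + 1, 2 - c the value of mu1 is unchanged, while mu0
  and, because a and b trade places, mu_infinity change sign. The pair (v, u) is x^(-1/k0) times the
  new Kummer pair, and homogeneity turns this factor into the powers of x on the right.\<close>

lemma identities_swap:
  assumes c: "1 - c = - 1 / real k0"
    and s: "s = Case_i \<and> s' = Case_iii \<or> s = Case_ii \<and> s' = Case_iv"
    and id: "identities s (k0, k1, kinf) N (P0, P1, Pinf) l0 l1
      (kummer_u (b - c + 1) (a - c + 1) (2 - c) x) (kummer_v (b - c + 1) (a - c + 1) (2 - c) l0 x)"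
  shows "identities s' (k0, k1, kinf) N (P0, P1, Pinf) l0 l1 (kummer_u a b c x) (kummer_v a b c l0 x)"
proof -
  define \<rho> where "\<rho> = zpow l0 (- 1 / real k0)"
  define u' v' where "u' = kummer_u (b - c + 1) (a - c + 1) (2 - c) x"
    and "v' = kummer_v (b - c + 1) (a - c + 1) (2 - c) l0 x"
  have v: "kummer_v a b c l0 x = \<rho> * u'"
    using c by (simp add: kummer_v_def kummer_u_def u'_def \<rho>_def hyperF_commute)
  have "v' = zpow l0 (1 / real k0) * kummer_u a b c x"
  proof -
    have "c - 1 = 1 / real k0" using c by simp
    then show ?thesis
      by (simp add: kummer_v_def kummer_u_def v'_def hyperF_commute[of b a] algebra_simps)
  qed
  then have u: "kummer_u a b c x = \<rho> * v'"
    by (simp add: \<rho>_def flip: zpow_add mult.assoc)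
  have \<rho>: "\<rho> ^ (N div k) = zpow l0 (- (real N / (real k0 * real k)))" if "k dvd N" for k
    by (simp add: \<rho>_def zpow_power N_div[OF that] mult.commute)
  have "zpow l0 (1 / real k0 - real N / real k0 ^ 2)
      = zpow l0 (- (real N / (real k0 * real k0))) * zpow l0 (1 / real k0)"
    by (simp flip: zpow_add add: power2_eq_square)
  then show ?thesis
    using s id unfolding u v u'_def[symmetric] v'_def[symmetric]
    by (auto simp: eval2_form_scale[OF forms(1)] eval2_form_scale[OF forms(2)] eval2_form_scale[OF forms(3)]
        \<rho>[OF dvd(1)] \<rho>[OF dvd(2)] \<rho>[OF dvd(3)])
qed

theorem identities_near_0:
  assumes abs: "\<bar>1 - c\<bar> = 1 / real k0" "\<bar>c - a - b\<bar> = 1 / real k1" "\<bar>a - b\<bar> = 1 / real kinf"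
    and s: "sign_pattern s (1 - c) (c - a - b) (a - b)" and x: "exp l0 = x" "norm x < 1"
  shows "identities s (k0, k1, kinf) N (P0, P1, Pinf) l0 (Ln (1 - x)) (kummer_u a b c x) (kummer_v a b c l0 x)"
proof (cases s)
  case Case_i
  then show ?thesis using abs s x by (auto intro!: identities_Case_i simp del: identities.simps)
next
  case Case_ii
  then show ?thesis using abs s x by (auto intro!: identities_Case_ii simp del: identities.simps)
next
  case Case_iii
  have "1 - c = - 1 / real k0" using Case_iii abs s by auto
  moreover have "identities Case_i (k0, k1, kinf) N (P0, P1, Pinf) l0 (Ln (1 - x))
      (kummer_u (b - c + 1) (a - c + 1) (2 - c) x) (kummer_v (b - c + 1) (a - c + 1) (2 - c) l0 x)"
    by (rule identities_Case_i) (use Case_iii abs s x in auto)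
  ultimately show ?thesis using Case_iii identities_swap by blast
next
  case Case_iv
  have "1 - c = - 1 / real k0" using Case_iv abs s by auto
  moreover have "identities Case_ii (k0, k1, kinf) N (P0, P1, Pinf) l0 (Ln (1 - x))
      (kummer_u (b - c + 1) (a - c + 1) (2 - c) x) (kummer_v (b - c + 1) (a - c + 1) (2 - c) l0 x)"
    by (rule identities_Case_ii) (use Case_iv abs s x in auto)
  ultimately show ?thesis using Case_iv identities_swap by blast
qed

theorem identities_continued:
  assumes abs: "\<bar>1 - c\<bar> = 1 / real k0" "\<bar>c - a - b\<bar> = 1 / real k1" "\<bar>a - b\<bar> = 1 / real kinf"
    and s: "sign_pattern s (1 - c) (c - a - b) (a - b)"
    and cont: "kummer_continuation a b c \<Omega> x l0 l1 u v" and t: "t \<in> \<Omega>"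
  shows "identities s (k0, k1, kinf) N (P0, P1, Pinf) (l0 t) (l1 t) (u t) (v t)"
proof -
  from cont obtain W where \<Omega>: "open \<Omega>" "connected \<Omega>"
    and hol: "l0 holomorphic_on \<Omega>" "l1 holomorphic_on \<Omega>" "u holomorphic_on \<Omega>" "v holomorphic_on \<Omega>"
    and ex: "\<And>t. t \<in> \<Omega> \<Longrightarrow> exp (l0 t) = x t"
    and W: "open W" "W \<noteq> {}" "W \<subseteq> \<Omega>"
    and germ: "\<And>t. t \<in> W \<Longrightarrow> norm (x t) < 1 \<and> l1 t = Ln (1 - x t) \<and> u t = kummer_u a b c (x t)
      \<and> v t = kummer_v a b c (l0 t) (x t)"
    unfolding kummer_continuation_def by blast
  have near: "identities s (k0, k1, kinf) N (P0, P1, Pinf) (l0 t) (l1 t) (u t) (v t)" if "t \<in> W" for t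
    using identities_near_0[OF abs s ex] germ[OF that] that W(3) by (auto simp del: identities.simps)
  have ext: "F t = G t" if "F holomorphic_on \<Omega>" "G holomorphic_on \<Omega>" "\<And>t. t \<in> W \<Longrightarrow> F t = G t" for F G
    by (rule analytic_continuation_open[OF W(1) \<Omega>(1) W(2) \<Omega>(2) W(3) that t])
  \<comment> \<open>The statement is split into its three components so that the identity theorem
    applies to each.\<close>
  define L where "L P t = eval2 P (fst (UV s (u t) (v t))) (snd (UV s (u t) (v t)))" for P t
  define R where "R t = rhs s (k0, k1, kinf) N (l0 t) (l1 t)" for t
  have iff: "identities s (k0, k1, kinf) N (P0, P1, Pinf) (l0 t) (l1 t) (u t) (v t) \<longleftrightarrow>
      L P0 t = fst (R t) \<and> L P1 t = fst (snd (R t)) \<and> L Pinf t = snd (snd (R t))" for t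
    by (cases s) (simp_all add: L_def R_def)
  have L: "L P holomorphic_on \<Omega>" for P
    unfolding L_def by (cases s) (simp_all add: holomorphic_on_eval2 hol)
  have R: "(\<lambda>t. fst (R t)) holomorphic_on \<Omega>" "(\<lambda>t. fst (snd (R t))) holomorphic_on \<Omega>"
    "(\<lambda>t. snd (snd (R t))) holomorphic_on \<Omega>"
    unfolding R_def by (cases s; simp add: holomorphic_intros hol)+
  have near': "L P0 t = fst (R t)" "L P1 t = fst (snd (R t))" "L Pinf t = snd (snd (R t))" if "t \<in> W" for t
    using near[OF that] unfolding iff by blast+
  show ?thesis
    unfolding iff using ext[OF L R(1) near'(1)] ext[OF L R(2) near'(2)] ext[OF L R(3) near'(3)] by blast
qed

theorem klein_theorem:
  assumes "explicit_forms (k0, k1, kinf) (P0, P1, Pinf)"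
  shows "\<exists>P0 P1 Pinf :: complex poly poly.
    homogeneous (N div k0) P0 \<and> homogeneous (N div k1) P1 \<and> homogeneous (N div kinf) Pinf \<and>
    explicit_forms (k0, k1, kinf) (P0, P1, Pinf) \<and>
    (\<forall>a b c :: real.
       \<bar>1 - c\<bar> = 1 / real k0 \<and> \<bar>c - a - b\<bar> = 1 / real k1 \<and> \<bar>a - b\<bar> = 1 / real kinf \<longrightarrow>
       (\<exists>!s. sign_pattern s (1 - c) (c - a - b) (a - b) \<or>
             sign_pattern s (1 - c) (c - b - a) (b - a)) \<and>
       (\<forall>s. sign_pattern s (1 - c) (c - a - b) (a - b) \<longrightarrow>
          (\<forall>x l0 :: complex. 0 < norm x \<and> norm x < 1 \<and> exp l0 = x \<longrightarrow>
             identities s (k0, k1, kinf) N (P0, P1, Pinf) l0 (Ln (1 - x))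
               (kummer_u a b c x) (kummer_v a b c l0 x)) \<and>
          (\<forall>\<Omega> x l0 l1 u v. kummer_continuation a b c \<Omega> x l0 l1 u v \<longrightarrow>
             (\<forall>t\<in>\<Omega>. identities s (k0, k1, kinf) N (P0, P1, Pinf) (l0 t) (l1 t) (u t) (v t)))))"
proof (intro exI conjI allI impI ballI)
  fix a b c :: real
  assume abs: "\<bar>1 - c\<bar> = 1 / real k0 \<and> \<bar>c - a - b\<bar> = 1 / real k1 \<and> \<bar>a - b\<bar> = 1 / real kinf"
  then have "1 - c \<noteq> 0" "c - a - b \<noteq> 0" "a - b \<noteq> 0" using k0 k1 kinf by auto
  moreover have *: "c - b - a = c - a - b" by simp
  ultimately show "\<exists>!s. sign_pattern s (1 - c) (c - a - b) (a - b) \<or>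
             sign_pattern s (1 - c) (c - b - a) (b - a)"
    unfolding * using ex1_sign_pattern[of "1 - c" "c - a - b" "a - b"] by simp
next
  fix a b c s l0 and x :: complex
  assume "\<bar>1 - c\<bar> = 1 / real k0 \<and> \<bar>c - a - b\<bar> = 1 / real k1 \<and> \<bar>a - b\<bar> = 1 / real kinf"
    "sign_pattern s (1 - c) (c - a - b) (a - b)" "0 < norm x \<and> norm x < 1 \<and> exp l0 = x"
  then show "identities s (k0, k1, kinf) N (P0, P1, Pinf) l0 (Ln (1 - x)) (kummer_u a b c x) (kummer_v a b c l0 x)"
    by (intro identities_near_0) simp_all
next
  fix a b c s \<Omega> x l0 l1 u v and t :: complex
  assume "\<bar>1 - c\<bar> = 1 / real k0 \<and> \<bar>c - a - b\<bar> = 1 / real k1 \<and> \<bar>a - b\<bar> = 1 / real kinf"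
    "sign_pattern s (1 - c) (c - a - b) (a - b)" "kummer_continuation a b c \<Omega> x l0 l1 u v" "t \<in> \<Omega>"
  then show "identities s (k0, k1, kinf) N (P0, P1, Pinf) (l0 t) (l1 t) (u t) (v t)"
    by (intro identities_continued[where \<Omega> = \<Omega> and x = x]) simp_all
qed (fact assms homogeneous_forms)+

end


section \<open>Construction of the forms\<close>

lemma form_of_degree_0: "form_of_degree d 0"
  by (simp add: form_of_degree_def)

lemma form_of_degree_1: "form_of_degree 0 1"
  by (auto simp: form_of_degree_def coeff_1 split: if_splits)

lemma form_of_degree_X: "form_of_degree 1 X"
  by (auto simp: form_of_degree_def X_def coeff_pCons split: nat.splits)

lemma form_of_degree_Y: "form_of_degree 1 Y"
  by (auto simp: form_of_degree_def Y_def coeff_pCons split: nat.splits)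

lemma form_of_degree_add: "form_of_degree d P \<Longrightarrow> form_of_degree d Q \<Longrightarrow> form_of_degree d (P + Q)"
  by (auto simp: form_of_degree_def) (metis add.right_neutral)

lemma form_of_degree_uminus: "form_of_degree d P \<Longrightarrow> form_of_degree d (- P)"
  by (simp add: form_of_degree_def)

lemma form_of_degree_diff: "form_of_degree d P \<Longrightarrow> form_of_degree d Q \<Longrightarrow> form_of_degree d (P - Q)"
  using form_of_degree_add[OF _ form_of_degree_uminus] by simp

lemma form_of_degree_sum: "(\<And>i. i \<in> A \<Longrightarrow> form_of_degree d (P i)) \<Longrightarrow> form_of_degree d (\<Sum>i\<in>A. P i)"
  by (induction A rule: infinite_finite_induct) (auto intro: form_of_degree_add form_of_degree_0)

lemma form_of_degree_mult:
  assumes "form_of_degree d P" "form_of_degree e Q"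
  shows "form_of_degree (d + e) (P * Q)"
  unfolding form_of_degree_def
proof (intro allI impI)
  fix i j assume "coeff (coeff (P * Q) j) i \<noteq> 0"
  moreover have "coeff (coeff (P * Q) j) i
      = (\<Sum>n\<le>j. \<Sum>m\<le>i. coeff (coeff P n) m * coeff (coeff Q (j - n)) (i - m))"
    by (simp add: coeff_mult coeff_sum)
  ultimately obtain n m where "n \<le> j" "m \<le> i" "coeff (coeff P n) m \<noteq> 0" "coeff (coeff Q (j - n)) (i - m) \<noteq> 0"
    by (metis (no_types, lifting) atMost_iff mult_eq_0_iff sum.neutral)
  with assms have "m + n = d" "(i - m) + (j - n) = e" by (auto simp: form_of_degree_def)
  with \<open>n \<le> j\<close> \<open>m \<le> i\<close> show "i + j = d + e" by simp
qed

lemma form_of_degree_power: "form_of_degree d P \<Longrightarrow> form_of_degree (n * d) (P ^ n)"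
  by (induction n) (auto intro: form_of_degree_1 form_of_degree_mult)

lemma form_of_degree_cscale: "form_of_degree d P \<Longrightarrow> form_of_degree d (z *\<^sub>C P)"
  by (simp add: form_of_degree_def cscale_def)

lemma form_of_degree_of_nat: "form_of_degree d P \<Longrightarrow> form_of_degree d (of_nat n * P)"
  using form_of_degree_cscale[of d P "of_nat n"] by (simp add: cscale_def of_nat_poly)

lemma form_of_degree_monomial: "form_of_degree (i + j) (X ^ i * Y ^ j)"
  using form_of_degree_mult[OF form_of_degree_power[OF form_of_degree_X] form_of_degree_power[OF form_of_degree_Y]]
  by simp

lemma cscale_simps [simp]:
  "1 *\<^sub>C P = P" "0 *\<^sub>C P = 0" "(- z) *\<^sub>C P = - (z *\<^sub>C P)"
proof -
  have "[:- z:] = - [:z:]" by simp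
  then show "(- z) *\<^sub>C P = - (z *\<^sub>C P)" unfolding cscale_def by (simp only: smult_minus_left)
  have "[:1:] = (1 :: complex poly)" "[:0:] = (0 :: complex poly)" by simp_all
  then show "1 *\<^sub>C P = P" "0 *\<^sub>C P = 0" unfolding cscale_def by (simp_all only: smult_1_left smult_0_left)
qed

lemma eval2_simps' [simp]:
  "eval2 0 x y = 0" "eval2 (of_nat n) x y = of_nat n" "eval2 (- P) x y = - eval2 P x y"
  "eval2 (\<Sum>i\<in>A. Q i) x y = (\<Sum>i\<in>A. eval2 (Q i) x y)"
  by (simp_all add: eval2_def of_nat_poly poly_sum)

text \<open>For a list of coefficients \<open>L\<close> this is
  \<open>s (L\<^sub>0 X\<^sup>i Y\<^sup>j + L\<^sub>1 / c X\<^sup>i\<^sup>-\<^sup>k Y\<^sup>j\<^sup>+\<^sup>k + L\<^sub>2 / c\<^sup>2 X\<^sup>i\<^sup>-\<^sup>2\<^sup>k Y\<^sup>j\<^sup>+\<^sup>2\<^sup>k + \<dots>)\<close>; the forms of a triple are invariant up to a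
  factor under \<open>Y \<mapsto> \<zeta> Y\<close>, \<open>\<zeta>\<close> a root of unity of order \<open>k = k\<^sub>0\<close>, and \<open>c\<close> clears the denominators.\<close>

fun list_form :: "nat \<Rightarrow> complex \<Rightarrow> complex \<Rightarrow> nat \<Rightarrow> nat \<Rightarrow> complex list \<Rightarrow> bipoly" where
  "list_form k c s i j [] = 0"
| "list_form k c s i j (a # L) = (a * s) *\<^sub>C (X ^ i * Y ^ j) + list_form k c (s / c) (i - k) (j + k) L"

text \<open>At X = 1 the form becomes a polynomial in the single variable y = z^k / c, up to the
  factor s z^j.\<close>

lemma eval2_list_form:
  "c \<noteq> 0 \<Longrightarrow> eval2 (list_form k c s i j L) 1 z = s * z ^ j * poly (Poly L) (z ^ k / c)"
  by (induction L arbitrary: s i j) (auto simp: power_add field_simps)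

text \<open>The length bound ensures that a truncating \<open>i - k\<close> can only meet the empty
  tail.\<close>

lemma form_of_degree_list_form:
  "k * (length L - 1) \<le> i \<Longrightarrow> form_of_degree (i + j) (list_form k c s i j L)"
proof (induction L arbitrary: s i j)
  case (Cons a L)
  show ?case
  proof (cases "L = []")
    case True
    then show ?thesis by (auto intro!: form_of_degree_add form_of_degree_cscale form_of_degree_monomial form_of_degree_0)
  next
    case False
    then have "length L = Suc (length L - 1)" by (cases L) auto
    with Cons.prems have i: "k \<le> i" "k * (length L - 1) \<le> i - k"
      by (metis add_leD1 diff_Suc_1 length_Cons mult_Suc_right, metis add_le_imp_le_diff add.commute diff_Suc_1 length_Cons mult_Suc_right)
    from Cons.IH[OF i(2), of "j + k" "s / c"] i(1)
    have "form_of_degree (i + j) (list_form k c (s / c) (i - k) (j + k) L)" by simp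
    then show ?thesis by (auto intro!: form_of_degree_add form_of_degree_cscale form_of_degree_monomial)
  qed
qed (simp add: form_of_degree_0)

text \<open>With f = F(y), g = z G(y), h = H(y), the rules z y' = k0 y and z^k0 = c y remove z from
  the three relations. \<open>J\<close> is the Jacobian relation divided by k0, \<open>S\<close> the
  syzygy, and \<open>Hess\<close> the Hessian relation divided by k0 z^(k0 - 2) / c.\<close>

lemma klein_forms_list_form:
  fixes c :: complex and F G H :: "complex poly" and d k0 k1 kinf N :: nat
  assumes lists: "F = Poly (1 # Fl)" "G = Poly Gl" "H = Poly (1 # Hl)" and c: "c \<noteq> 0"
    and k: "k0 \<ge> 2" "k1 \<ge> 2" "kinf \<ge> 2" "N > 0"
    and order: "2 / real N = 1 / real k0 + 1 / real k1 + 1 / real kinf - 1"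
    and dvd: "k0 dvd N" "k1 dvd N" "kinf dvd N"
    and len: "k0 * length Fl \<le> N div kinf" "k0 * (length Gl - 1) \<le> N div k0 - 1" "k0 * length Hl \<le> N div k1"
    and d: "d = N div kinf"
    and J: "(G + smult (of_nat k0) (pCons 0 (pderiv G))) * F - smult (of_nat kinf) (pCons 0 (G * pderiv F)) = H ^ (k1 - 1)"
    and S: "smult c (pCons 0 (G ^ k0)) + H ^ k1 = F ^ kinf"
    and Hess: "smult (of_nat kinf ^ 2) (smult (of_nat d) (F * (smult (of_nat k0 - 1) (pderiv F)
        + smult (of_nat k0) (pCons 0 (pderiv (pderiv F))))) - smult ((of_nat d - 1) * of_nat k0) (pCons 0 (pderiv F ^ 2)))
      = smult ((of_nat d - 1) * of_nat k0 * c) (G ^ (k0 - 2) * H ^ (k1 - 2))"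
  obtains f1 f2 g1 h1 where
    "klein_forms k0 k1 kinf N (list_form k0 c 1 (N div k0 - 1) 1 Gl) (list_form k0 c 1 (N div k1) 0 (1 # Hl))
      (list_form k0 c 1 (N div kinf) 0 (1 # Fl)) f1 f2 g1 h1"
proof -
  obtain m where m: "k0 = m + 2" using k(1) nat_le_iff_add by (metis add.commute)
  define y where "y z = z ^ k0 / c" for z
  define y1 where "y1 z = of_nat k0 * z ^ (m + 1) / c" for z
  have dy: "(y has_field_derivative y1 z) (at z)" for z
    unfolding y_def y1_def by (rule derivative_eq_intros refl)+ (use c in \<open>simp_all add: m\<close>)
  have dp: "((\<lambda>z. poly P (y z)) has_field_derivative poly (pderiv P) (y z) * y1 z) (at z)" for P z
    by (rule DERIV_chain2[OF poly_DERIV dy])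
  have dy1: "(y1 has_field_derivative of_nat k0 * (of_nat k0 - 1) * z ^ m / c) (at z)" for z
    unfolding y1_def by (rule derivative_eq_intros refl)+ (use c in \<open>simp_all add: m field_simps\<close>)
  have f: "eval2 (list_form k0 c 1 (N div kinf) 0 (1 # Fl)) 1 = (\<lambda>z. poly F (y z))"
    and g: "eval2 (list_form k0 c 1 (N div k0 - 1) 1 Gl) 1 = (\<lambda>z. z * poly G (y z))"
    and h: "eval2 (list_form k0 c 1 (N div k1) 0 (1 # Hl)) 1 = (\<lambda>z. poly H (y z))"
    unfolding fun_eq_iff eval2_list_form[OF c] lists y_def by simp_all
  have zy: "z * y1 z = of_nat k0 * y z" "z ^ k0 = c * y z" for z
    using c by (simp_all add: y_def y1_def m)
  have y0: "y 0 = 0" "y1 0 = 0" by (simp_all add: y_def y1_def m)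
  have cnz: "of_nat k0 \<noteq> (0::complex)" using k by auto
  have J': "(poly G (y z) + of_nat k0 * (y z * poly (pderiv G) (y z))) * poly F (y z)
      - of_nat kinf * (y z * (poly G (y z) * poly (pderiv F) (y z))) = poly H (y z) ^ (k1 - 1)" for z
    using arg_cong[OF J, of "\<lambda>p. poly p (y z)"] by (simp add: poly_power mult_ac)
  have S': "c * (y z * poly G (y z) ^ k0) + poly H (y z) ^ k1 = poly F (y z) ^ kinf" for z
    using arg_cong[OF S, of "\<lambda>p. poly p (y z)"] by (simp add: poly_power mult_ac)
  have H': "of_nat kinf ^ 2 * (of_nat d * (poly F (y z) * ((of_nat k0 - 1) * poly (pderiv F) (y z)
        + of_nat k0 * (y z * poly (pderiv (pderiv F)) (y z)))) - (of_nat d - 1) * of_nat k0 * (y z * poly (pderiv F) (y z) ^ 2))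
      = (of_nat d - 1) * of_nat k0 * c * (poly G (y z) ^ m * poly H (y z) ^ (k1 - 2))" for z
    using arg_cong[OF Hess, of "\<lambda>p. poly p (y z)"] by (simp add: poly_power m mult_ac)
  have Npos: "N div k0 > 0" using dvd(1) k(4) by (auto elim!: dvdE)
  show thesis
  proof (rule that, unfold_locales)
    show "form_of_degree (N div k0) (list_form k0 c 1 (N div k0 - 1) 1 Gl)"
      using form_of_degree_list_form[OF len(2), of 1 c 1] Npos by simp
    show "form_of_degree (N div k1) (list_form k0 c 1 (N div k1) 0 (1 # Hl))"
      using form_of_degree_list_form[of k0 "1 # Hl" "N div k1" 0 c 1] len(3) by (simp del: list_form.simps)
    show "form_of_degree (N div kinf) (list_form k0 c 1 (N div kinf) 0 (1 # Fl))"
      using form_of_degree_list_form[of k0 "1 # Fl" "N div kinf" 0 c 1] len(1) by (simp del: list_form.simps)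
    show "eval2 (list_form k0 c 1 (N div kinf) 0 (1 # Fl)) 1 0 = 1"
      "eval2 (list_form k0 c 1 (N div k0 - 1) 1 Gl) 1 0 = 0"
      "eval2 (list_form k0 c 1 (N div k1) 0 (1 # Hl)) 1 0 = 1"
      unfolding f g h by (simp_all add: y0 lists)
    show "poly (pderiv F) (y 0) * y1 0 = 0" by (simp add: y0)
    show "(eval2 (list_form k0 c 1 (N div kinf) 0 (1 # Fl)) 1 has_field_derivative poly (pderiv F) (y z) * y1 z) (at z)"
      "(eval2 (list_form k0 c 1 (N div k1) 0 (1 # Hl)) 1 has_field_derivative poly (pderiv H) (y z) * y1 z) (at z)" for z
      unfolding f h by (rule dp)+
    show "(eval2 (list_form k0 c 1 (N div k0 - 1) 1 Gl) 1 has_field_derivative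
        poly G (y z) + z * (poly (pderiv G) (y z) * y1 z)) (at z)" for z
      unfolding g by (rule derivative_eq_intros dp refl)+ simp
    show "((\<lambda>z. poly (pderiv F) (y z) * y1 z) has_field_derivative
        poly (pderiv (pderiv F)) (y z) * y1 z ^ 2 + poly (pderiv F) (y z) * (of_nat k0 * (of_nat k0 - 1) * z ^ m / c)) (at z)" for z
      by (rule derivative_eq_intros dp dy1 refl)+ (simp add: power2_eq_square mult_ac)
    show "eval2 (list_form k0 c 1 (N div k0 - 1) 1 Gl) 1 z ^ k0 + eval2 (list_form k0 c 1 (N div k1) 0 (1 # Hl)) 1 z ^ k1
        = eval2 (list_form k0 c 1 (N div kinf) 0 (1 # Fl)) 1 z ^ kinf" for z
      unfolding f g h using S'[of z] by (simp add: power_mult_distrib zy(2)[of z] mult.assoc)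
    show "of_nat k0 * (poly G (y z) + z * (poly (pderiv G) (y z) * y1 z)) * eval2 (list_form k0 c 1 (N div kinf) 0 (1 # Fl)) 1 z
        - of_nat kinf * eval2 (list_form k0 c 1 (N div k0 - 1) 1 Gl) 1 z * (poly (pderiv F) (y z) * y1 z)
        = of_nat k0 * eval2 (list_form k0 c 1 (N div k1) 0 (1 # Hl)) 1 z ^ (k1 - 1)" for z
      unfolding f g h J'[of z, symmetric] using zy(1)[of z] by algebra
    show "of_nat kinf ^ 2 * (of_nat (N div kinf) * eval2 (list_form k0 c 1 (N div kinf) 0 (1 # Fl)) 1 z
          * (poly (pderiv (pderiv F)) (y z) * y1 z ^ 2 + poly (pderiv F) (y z) * (of_nat k0 * (of_nat k0 - 1) * z ^ m / c))
        - (of_nat (N div kinf) - 1) * (poly (pderiv F) (y z) * y1 z) ^ 2)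
      = (of_nat (N div kinf) - 1) * of_nat k0 ^ 2 * eval2 (list_form k0 c 1 (N div k0 - 1) 1 Gl) 1 z ^ (k0 - 2)
          * eval2 (list_form k0 c 1 (N div k1) 0 (1 # Hl)) 1 z ^ (k1 - 2)" for z
    proof -
      \<comment> \<open>\<open>r\<close> is the factor shared by y'^2 = k0^2 r y, y'' = k0 (k0 - 1)
        r and z^(k0 - 2) = c r.\<close>
      define r K a b b1 b2 Q where "r = z ^ m / c" and "K = (of_nat k0 :: complex)" and "a = y z"
        and "b = poly F (y z)" and "b1 = poly (pderiv F) (y z)" and "b2 = poly (pderiv (pderiv F)) (y z)"
        and "Q = poly G (y z) ^ m * poly H (y z) ^ (k1 - 2)"
      have y1: "y1 z ^ 2 = K ^ 2 * r * a" "K * (K - 1) * z ^ m / c = K * (K - 1) * r" "z ^ m = c * r"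
        using c by (simp_all add: y1_def y_def r_def K_def a_def m power2_eq_square)
      have e: "of_nat kinf ^ 2 * (of_nat d * (b * ((K - 1) * b1 + K * (a * b2))) - (of_nat d - 1) * K * (a * b1 ^ 2))
        = (of_nat d - 1) * K * c * Q"
        using H'[of z] by (simp only: K_def a_def b_def b1_def b2_def Q_def)
      have "of_nat kinf ^ 2 * (of_nat d * b * (b2 * y1 z ^ 2 + b1 * (K * (K - 1) * z ^ m / c))
          - (of_nat d - 1) * (b1 ^ 2 * y1 z ^ 2)) = (of_nat d - 1) * K ^ 2 * (c * r * Q)"
        unfolding y1(1,2) using e by algebra
      also have "c * r * Q = (z * poly G (y z)) ^ m * poly H (y z) ^ (k1 - 2)"
        unfolding y1(3)[symmetric] Q_def by (simp add: power_mult_distrib)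
      finally show ?thesis
        unfolding f g h unfolding d[symmetric] by (simp add: K_def b_def b1_def b2_def power_mult_distrib m mult.assoc)
    qed
  qed (use k order dvd in simp_all)
qed

section \<open>The polyhedral triples\<close>

definition realized :: "nat \<Rightarrow> nat \<Rightarrow> nat \<Rightarrow> nat \<Rightarrow> bool" where
  "realized k0 k1 kinf N \<longleftrightarrow> (\<exists>P0 P1 Pinf f1 f2 g1 h1.
     klein_forms k0 k1 kinf N P0 P1 Pinf f1 f2 g1 h1 \<and> explicit_forms (k0, k1, kinf) (P0, P1, Pinf))"

lemma realized_list_form:
  fixes c :: complex and Fl Gl Hl :: "complex list" and k0 k1 kinf N :: nat
  defines "d \<equiv> N div kinf" and "F \<equiv> Poly (1 # Fl)" and "G \<equiv> Poly Gl" and "H \<equiv> Poly (1 # Hl)"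
  assumes "c \<noteq> 0" "k0 \<ge> 2" "k1 \<ge> 2" "kinf \<ge> 2" "N > 0"
    and "2 / real N = 1 / real k0 + 1 / real k1 + 1 / real kinf - 1"
    and "k0 dvd N" "k1 dvd N" "kinf dvd N"
    and "k0 * length Fl \<le> N div kinf" "k0 * (length Gl - 1) \<le> N div k0 - 1" "k0 * length Hl \<le> N div k1"
    and "(G + smult (of_nat k0) (pCons 0 (pderiv G))) * F - smult (of_nat kinf) (pCons 0 (G * pderiv F)) = H ^ (k1 - 1)"
    and "smult c (pCons 0 (G ^ k0)) + H ^ k1 = F ^ kinf"
    and "smult (of_nat kinf ^ 2) (smult (of_nat d) (F * (smult (of_nat k0 - 1) (pderiv F)
        + smult (of_nat k0) (pCons 0 (pderiv (pderiv F))))) - smult ((of_nat d - 1) * of_nat k0) (pCons 0 (pderiv F ^ 2)))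
      = smult ((of_nat d - 1) * of_nat k0 * c) (G ^ (k0 - 2) * H ^ (k1 - 2))"
    and "explicit_forms (k0, k1, kinf) (list_form k0 c 1 (N div k0 - 1) 1 Gl,
      list_form k0 c 1 (N div k1) 0 (1 # Hl), list_form k0 c 1 (N div kinf) 0 (1 # Fl))"
  shows "realized k0 k1 kinf N"
proof -
  obtain f1 f2 g1 h1 where "klein_forms k0 k1 kinf N (list_form k0 c 1 (N div k0 - 1) 1 Gl)
      (list_form k0 c 1 (N div k1) 0 (1 # Hl)) (list_form k0 c 1 (N div kinf) 0 (1 # Fl)) f1 f2 g1 h1"
    using klein_forms_list_form[OF F_def[THEN meta_eq_to_obj_eq] G_def[THEN meta_eq_to_obj_eq]
      H_def[THEN meta_eq_to_obj_eq] assms(5-16) d_def[THEN meta_eq_to_obj_eq] assms(17-19)] .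
  with assms(20) show ?thesis unfolding realized_def by blast
qed

lemma power_2_to_5:
  fixes p :: "'a :: comm_monoid_mult"
  shows "p ^ 2 = p * p" "p ^ 3 = p * (p * p)" "p ^ 4 = (p * p) * (p * p)" "p ^ 5 = p * ((p * p) * (p * p))"
  by (simp_all add: eval_nat_numeral mult.assoc)

lemmas pCons_power_simps = power_2_to_5[of "pCons a p" for a p]


text \<open>In the normalization of case (i) \<open>P\<^sub>j(u, v)\<close> is known, so with \<open>d = N / k\<^sub>j\<close> the dehomogenized forms are
  \<open>u\<^sup>-\<^sup>d\<close>, \<open>x\<^sup>1\<^sup>/\<^sup>k u\<^sup>-\<^sup>d\<close> and \<open>(1 - x)\<^sup>1\<^sup>/\<^sup>k u\<^sup>-\<^sup>d\<close>; their expansions in powers of \<open>v / u\<close> terminate, which gives the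
  lists below, also for the four triples without a formula in the paper.\<close>

lemma realized_T1: "realized 2 3 3 12"
  by (rule realized_list_form[where c = 36
      and Fl = "[6, -3]"
      and Gl = "[1, 0, 3]"
      and Hl = "[-6, -3]"])
    (simp_all add: pCons_power_simps pderiv_pCons explicit_forms_def T1_forms_def algebra_simps del: One_nat_def add_2_eq_Suc add_2_eq_Suc')

lemma realized_T2: "realized 3 2 3 12"
  by (rule realized_list_form[where c = 64
      and Fl = "[8]"
      and Gl = "[1, -1]"
      and Hl = "[-20, -8]"])
    (simp_all add: pCons_power_simps pderiv_pCons explicit_forms_def T2_forms_def algebra_simps del: One_nat_def add_2_eq_Suc add_2_eq_Suc')

text \<open>Exchanging k1 and kinf amounts to y -> -y with F and H interchanged, since this
  preserves c y G^k0 + H^k1 = F^kinf. The lists of T2 and T3, O1 and O2, O3 and O4, O5 and O6, and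
  likewise of the icosahedral pairs, are related in this way.\<close>

lemma realized_T3: "realized 3 3 2 12"
  by (rule realized_list_form[where c = 64
      and Fl = "[20, -8]"
      and Gl = "[1, 1]"
      and Hl = "[-8]"])
    (simp_all add: pCons_power_simps pderiv_pCons explicit_forms_def T3_forms_def algebra_simps del: One_nat_def add_2_eq_Suc add_2_eq_Suc')

lemma realized_O1: "realized 2 3 4 24"
  by (rule realized_list_form[where c = 432
      and Fl = "[45, -405, -729]"
      and Gl = "[1, -11, 594, 5346, -8019, 59049]"
      and Hl = "[-84, -378, -6804, 6561]"])
    (simp_all add: pCons_power_simps pderiv_pCons explicit_forms_def O1_forms_def algebra_simps del: One_nat_def add_2_eq_Suc add_2_eq_Suc')

lemma realized_O2: "realized 2 4 3 24"
  by (rule realized_list_form[where c = 432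
      and Fl = "[84, -378, 6804, 6561]"
      and Gl = "[1, 11, 594, -5346, -8019, -59049]"
      and Hl = "[-45, -405, 729]"])
    (simp_all add: pCons_power_simps pderiv_pCons explicit_forms_def O2_forms_def algebra_simps del: One_nat_def add_2_eq_Suc add_2_eq_Suc')

lemma realized_O3: "realized 3 2 4 24"
  by (rule realized_list_form[where c = 256
      and Fl = "[20, -8]"
      and Gl = "[1, -7, -8]"
      and Hl = "[-88, 0, -704, -64]"])
    (simp_all add: pCons_power_simps pderiv_pCons explicit_forms_def O3_forms_def algebra_simps del: One_nat_def add_2_eq_Suc add_2_eq_Suc')

lemma realized_O4: "realized 3 4 2 24"
  by (rule realized_list_form[where c = 256
      and Fl = "[88, 0, 704, -64]"
      and Gl = "[1, 7, -8]"
      and Hl = "[-20, -8]"])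
    (simp_all add: pCons_power_simps pderiv_pCons explicit_forms_def O4_forms_def algebra_simps del: One_nat_def add_2_eq_Suc add_2_eq_Suc')

text \<open>Up to scaling of Y these are the classical octahedral forms xy(x^4 - y^4), x^8 + 14 x^4
  y^4 + y^8, x^12 - 33 x^8 y^4 - 33 x^4 y^8 + y^12; 108 is the constant of their syzygy.\<close>

lemma realized_O5: "realized 4 2 3 24"
  by (rule realized_list_form[where c = 108
      and Fl = "[14, 1]"
      and Gl = "[1, -1]"
      and Hl = "[-33, -33, 1]"])
    (simp_all add: pCons_power_simps pderiv_pCons explicit_forms_def O5_forms_def algebra_simps del: One_nat_def add_2_eq_Suc add_2_eq_Suc')

lemma realized_O6: "realized 4 3 2 24"
  by (rule realized_list_form[where c = 108
      and Fl = "[33, -33, -1]"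
      and Gl = "[1, 1]"
      and Hl = "[-14, 1]"])
    (simp_all add: pCons_power_simps pderiv_pCons explicit_forms_def O6_forms_def algebra_simps del: One_nat_def add_2_eq_Suc add_2_eq_Suc')

lemma realized_I1: "realized 2 3 5 60"
  by (rule realized_list_form[where c = 13500
      and Fl = "[990, -334125, -20047500, -3383015625, 101490468750, 1037970703125]"
      and Gl = "[1, -580, 716445, 211410000, 41026753125, -4102675312500, 2630840544140625, 0, 
       -26637260509423828125, 420588323833007812500, -42584567788092041015625, 
       -2221803536770019531250000, -76235633855421295166015625, 624882244716567993164062500, 
       -10908504703026294708251953125]"
      and Hl = "[-2850, -192375, -346275000, -50642718750, 7596407812500, -512757527343750, 
       -35498598046875000, -199679614013671875, -29951942102050781250, 106408215362548828125]"])
    (simp_all add: pCons_power_simps pderiv_pCons explicit_forms_def I1_forms_def algebra_simps del: One_nat_def add_2_eq_Suc add_2_eq_Suc')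

lemma realized_I2: "realized 2 5 3 60"
  by (rule realized_list_form[where c = 13500
      and Fl = "[2850, -192375, 346275000, -50642718750, -7596407812500, -512757527343750, 
       35498598046875000, -199679614013671875, 29951942102050781250, 106408215362548828125]"
      and Gl = "[1, 580, 716445, -211410000, 41026753125, 4102675312500, 2630840544140625, 0, 
       -26637260509423828125, -420588323833007812500, -42584567788092041015625, 
       2221803536770019531250000, -76235633855421295166015625, -624882244716567993164062500, 
       -10908504703026294708251953125]"
      and Hl = "[-990, -334125, 20047500, -3383015625, -101490468750, 1037970703125]"])
    (simp_all add: pCons_power_simps pderiv_pCons explicit_forms_def)

lemma realized_I3: "realized 3 2 5 60"
  by (rule realized_list_form[where c = 8000
      and Fl = "[440, -10560, -140800, 102400]"
      and Gl = "[1, -285, -9120, -790400, 2918400, -29184000, -32768000]"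
      and Hl = "[-2900, 156600, -32016000, -2433216000, 0, -778629120000, 3278438400000, 5131468800000, 
       30408704000000, 3355443200000]"])
    (simp_all add: pCons_power_simps pderiv_pCons explicit_forms_def)

lemma realized_I4: "realized 3 5 2 60"
  by (rule realized_list_form[where c = 8000
      and Fl = "[2900, 156600, 32016000, -2433216000, 0, -778629120000, -3278438400000, 5131468800000, 
       -30408704000000, 3355443200000]"
      and Gl = "[1, 285, -9120, 790400, 2918400, 29184000, -32768000]"
      and Hl = "[-440, -10560, 140800, 102400]"])
    (simp_all add: pCons_power_simps pderiv_pCons explicit_forms_def)

lemma realized_I5: "realized 5 2 3 60"
  by (rule realized_list_form[where c = 1728
      and Fl = "[228, 494, -228, 1]"
      and Gl = "[1, -11, -1]"
      and Hl = "[-522, -10005, 0, -10005, 522, 1]"])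
    (simp_all add: pCons_power_simps pderiv_pCons explicit_forms_def)

text \<open>Up to scaling of Y and signs, Klein's icosahedral forms of degrees 12, 20, 30; 1728 is
  the constant of their syzygy.\<close>

lemma realized_I6: "realized 5 3 2 60"
  by (rule realized_list_form[where c = 1728
      and Fl = "[522, -10005, 0, -10005, -522, 1]"
      and Gl = "[1, 11, -1]"
      and Hl = "[-228, 494, 228, 1]"])
    (simp_all add: pCons_power_simps pderiv_pCons explicit_forms_def I6_forms_def algebra_simps del: One_nat_def add_2_eq_Suc add_2_eq_Suc')

section \<open>The dihedral triples\<close>

lemma realized_D3:
  assumes n: "n \<ge> 2"
  shows "realized n 2 2 (2 * n)"
proof -
  have one: "[:1:] ^ k = ([:1:] :: complex poly)" for k by (simp flip: one_pCons)
  show ?thesis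
  \<comment> \<open>F = 1 + y, G = 1 and H = 1 - y: the syzygy is (1 + y)^2 - (1 - y)^2 = 4
    y.\<close>
  proof (rule realized_list_form[where c = 4 and Fl = "[1]" and Gl = "[1]" and Hl = "[- 1]"])
    show "2 / real (2 * n) = 1 / real n + 1 / real 2 + 1 / real 2 - 1" by simp
    have "list_form n 4 1 (2 * n div n - 1) 1 [1] = X * Y" "list_form n 4 1 (2 * n div 2) 0 [1, - 1] = X ^ n - (1 / 4) *\<^sub>C Y ^ n"
      "list_form n 4 1 (2 * n div 2) 0 [1, 1] = X ^ n + (1 / 4) *\<^sub>C Y ^ n"
      using n by simp_all
    then show "explicit_forms (n, 2, 2) (list_form n 4 1 (2 * n div n - 1) 1 [1],
        list_form n 4 1 (2 * n div 2) 0 [1, - 1], list_form n 4 1 (2 * n div 2) 0 [1, 1])"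
      using D_forms_2 by (auto simp: explicit_forms_def D3_forms_def)
  qed (use n in \<open>simp_all add: pderiv_pCons pCons_power_simps algebra_simps one\<close>)
qed

lemma sum_even_odd_terms:
  fixes a :: "nat \<Rightarrow> 'a :: comm_monoid_add"
  shows "(\<Sum>k=0..m. a (2 * k)) + (\<Sum>k=0..m. a (2 * k + 1)) = (\<Sum>k\<le>2 * m + 1. a k)"
  by (induction m) (simp_all add: algebra_simps)

lemma binomial_even_odd:
  fixes x :: "'a :: comm_ring_1"
  shows "(\<Sum>k=0..n div 2. of_nat (n choose (2 * k)) * x ^ (2 * k))
      + (\<Sum>k=0..n div 2. of_nat (n choose (2 * k + 1)) * x ^ (2 * k + 1)) = (1 + x) ^ n"
    and "(\<Sum>k=0..n div 2. of_nat (n choose (2 * k)) * x ^ (2 * k))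
      - (\<Sum>k=0..n div 2. of_nat (n choose (2 * k + 1)) * x ^ (2 * k + 1)) = (1 - x) ^ n"
proof -
  have *: "(\<Sum>k=0..n div 2. of_nat (n choose (2 * k)) * x ^ (2 * k))
      + (\<Sum>k=0..n div 2. of_nat (n choose (2 * k + 1)) * x ^ (2 * k + 1)) = (1 + x) ^ n" for x :: 'a
  proof -
    have "(1 + x) ^ n = (\<Sum>k\<le>n. of_nat (n choose k) * x ^ k)"
      using binomial_ring[of x 1 n] by (simp add: add.commute)
    \<comment> \<open>For even n this adds the index n + 1, where the binomial coefficient is
      0.\<close>
    also have "\<dots> = (\<Sum>k\<le>2 * (n div 2) + 1. of_nat (n choose k) * x ^ k)"
      by (intro sum.mono_neutral_left) (auto simp: binomial_eq_0)
    finally show ?thesis using sum_even_odd_terms[of "\<lambda>k. of_nat (n choose k) * x ^ k" "n div 2"] by simp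
  qed
  show "(\<Sum>k=0..n div 2. of_nat (n choose (2 * k)) * x ^ (2 * k))
      + (\<Sum>k=0..n div 2. of_nat (n choose (2 * k + 1)) * x ^ (2 * k + 1)) = (1 + x) ^ n" by (rule *)
  show "(\<Sum>k=0..n div 2. of_nat (n choose (2 * k)) * x ^ (2 * k))
      - (\<Sum>k=0..n div 2. of_nat (n choose (2 * k + 1)) * x ^ (2 * k + 1)) = (1 - x) ^ n"
    using *[of "- x"] by (simp add: sum_negf)
qed

text \<open>Coefficient lists would have a length depending on n. The closed form reduces the
  relations, uniformly in n, to algebra with the powers of 1 + s z and 1 - s z.\<close>

lemma eval2_even_odd:
  "eval2 (\<Sum>k=0..n div 2. of_nat (n choose (2 * k)) * X ^ (n - 2 * k) * (s *\<^sub>C Y) ^ (2 * k)) 1 z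
    = ((1 + s * z) ^ n + (1 - s * z) ^ n) / 2"
  "eval2 (\<Sum>k=0..n div 2. of_nat (n choose (2 * k + 1)) * X ^ (n - 2 * k - 1) * (s *\<^sub>C Y) ^ (2 * k + 1)) 1 z
    = ((1 + s * z) ^ n - (1 - s * z) ^ n) / 2"
  unfolding binomial_even_odd[symmetric] by (simp_all add: field_simps)

lemma form_of_degree_even_odd:
  "form_of_degree n (\<Sum>k=0..n div 2. of_nat (n choose (2 * k)) * X ^ (n - 2 * k) * (s *\<^sub>C Y) ^ (2 * k))"
  "form_of_degree n (\<Sum>k=0..n div 2. of_nat (n choose (2 * k + 1)) * X ^ (n - 2 * k - 1) * (s *\<^sub>C Y) ^ (2 * k + 1))"
proof -
  have *: "form_of_degree n (of_nat (n choose j) * X ^ (n - j) * (s *\<^sub>C Y) ^ j)" for j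
  proof (cases "j \<le> n")
    case True
    have "form_of_degree ((n - j) * 1 + j * 1) (X ^ (n - j) * (s *\<^sub>C Y) ^ j)"
      by (intro form_of_degree_mult form_of_degree_power form_of_degree_cscale form_of_degree_X form_of_degree_Y)
    then show ?thesis using True by (simp add: form_of_degree_of_nat mult.assoc)
  qed (simp add: binomial_eq_0 form_of_degree_0)
  show "form_of_degree n (\<Sum>k=0..n div 2. of_nat (n choose (2 * k)) * X ^ (n - 2 * k) * (s *\<^sub>C Y) ^ (2 * k))"
    by (intro form_of_degree_sum *)
  show "form_of_degree n (\<Sum>k=0..n div 2. of_nat (n choose (2 * k + 1)) * X ^ (n - 2 * k - 1) * (s *\<^sub>C Y) ^ (2 * k + 1))"
    by (intro form_of_degree_sum) (use * in \<open>simp only: diff_diff_eq\<close>)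
qed

lemma form_of_degree_quadratic: "form_of_degree 2 (X ^ 2 + s *\<^sub>C Y ^ 2)" "form_of_degree 2 (X ^ 2 - s *\<^sub>C Y ^ 2)"
  using form_of_degree_monomial[of 2 0] form_of_degree_monomial[of 0 2]
  by (auto intro!: form_of_degree_add form_of_degree_diff form_of_degree_cscale simp: numeral_2_eq_2)

text \<open>With p = (1 + s z)^n and q = (1 - s z)^n the forms are i (p - q)/2, (p + q)/2 and an
  n-th root of p q, so the syzygy is ((p + q)/2)^2 - ((p - q)/2)^2 = p q.\<close>

lemma realized_D1:
  assumes n: "n \<ge> 2"
  shows "realized 2 2 n (2 * n)"
proof -
  obtain m where m: "n = m + 2" using n nat_le_iff_add by (metis add.commute)
  define s where "s = 1 / (\<i> * of_nat n)"
  obtain P0 P1 Pinf where P: "D1_forms n = (P0, P1, Pinf)" by (cases "D1_forms n")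
  have nz: "of_nat n \<noteq> (0::complex)" and N: "2 * n div 2 = n" "2 * n div n = 2" using n by auto
  have s: "s * of_nat n = - \<i>" "1 / of_nat n ^ 2 = - (s ^ 2)" using nz by (simp_all add: s_def field_simps power2_eq_square)
  have e: "eval2 P0 1 = (\<lambda>z. \<i> * (((1 + s * z) ^ n - (1 - s * z) ^ n) / 2))"
    "eval2 P1 1 = (\<lambda>z. ((1 + s * z) ^ n + (1 - s * z) ^ n) / 2)"
    "eval2 Pinf 1 = (\<lambda>z. 1 - s ^ 2 * z ^ 2)"
    using P s(2) unfolding D1_forms_def s_def[symmetric] prod.inject
    by (auto simp only: fun_eq_iff eval2_even_odd eval2_simps s(2)) simp_all
  have "klein_forms 2 2 n (2 * n) P0 P1 Pinf (\<lambda>z. - 2 * s ^ 2 * z) (\<lambda>z. - 2 * s ^ 2)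
    (\<lambda>z. \<i> * (s * of_nat n * ((1 + s * z) ^ (m + 1) + (1 - s * z) ^ (m + 1)) / 2))
    (\<lambda>z. s * of_nat n * ((1 + s * z) ^ (m + 1) - (1 - s * z) ^ (m + 1)) / 2)"
  proof (unfold_locales, unfold e)
    show "2 / real (2 * n) = 1 / real 2 + 1 / real 2 + 1 / real n - 1" by simp
    show "form_of_degree (2 * n div 2) P0" "form_of_degree (2 * n div 2) P1" "form_of_degree (2 * n div n) Pinf"
      using P unfolding D1_forms_def N
      by (auto simp only: prod.inject intro!: form_of_degree_cscale form_of_degree_even_odd form_of_degree_quadratic)
    fix z
    have nm: "n - Suc 0 = m + 1" using m by simp
    define a b where "a = (1 + s * z) ^ (m + 1)" and "b = (1 - s * z) ^ (m + 1)"
    have ab: "(1 + s * z) ^ n = a * (1 + s * z)" "(1 - s * z) ^ n = b * (1 - s * z)"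
      by (simp_all add: a_def b_def m mult.commute)
    show "((\<lambda>z. 1 - s ^ 2 * z ^ 2) has_field_derivative - 2 * s ^ 2 * z) (at z)"
      "((\<lambda>z. - 2 * s ^ 2 * z) has_field_derivative - 2 * s ^ 2) (at z)"
      by (auto intro!: derivative_eq_intros)
    have d: "((\<lambda>z. (1 + s * z) ^ n) has_field_derivative s * of_nat n * (1 + s * z) ^ (m + 1)) (at z)"
      "((\<lambda>z. (1 - s * z) ^ n) has_field_derivative - (s * of_nat n * (1 - s * z) ^ (m + 1))) (at z)"
      by ((rule derivative_eq_intros refl)+, simp add: nm)+
    show "((\<lambda>z. \<i> * (((1 + s * z) ^ n - (1 - s * z) ^ n) / 2)) has_field_derivative
        \<i> * (s * of_nat n * ((1 + s * z) ^ (m + 1) + (1 - s * z) ^ (m + 1)) / 2)) (at z)"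
      "((\<lambda>z. ((1 + s * z) ^ n + (1 - s * z) ^ n) / 2) has_field_derivative
        s * of_nat n * ((1 + s * z) ^ (m + 1) - (1 - s * z) ^ (m + 1)) / 2) (at z)"
      by (rule DERIV_cong[OF DERIV_cmult[OF DERIV_cdivide[OF DERIV_diff[OF d]]]]
          DERIV_cong[OF DERIV_cdivide[OF DERIV_add[OF d]]], simp add: algebra_simps)+
    have "(1 - s ^ 2 * z ^ 2) ^ n = (1 + s * z) ^ n * (1 - s * z) ^ n"
      by (simp add: power_mult_distrib [symmetric] algebra_simps power2_eq_square)
    then show "(\<i> * (((1 + s * z) ^ n - (1 - s * z) ^ n) / 2)) ^ 2 + (((1 + s * z) ^ n + (1 - s * z) ^ n) / 2) ^ 2
        = (1 - s ^ 2 * z ^ 2) ^ n"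
      by (simp add: power_mult_distrib power_divide field_simps power2_eq_square)
    have "of_nat 2 * (\<i> * (s * of_nat n * (a + b) / 2)) * (1 - s ^ 2 * z ^ 2)
          - of_nat n * (\<i> * ((a * (1 + s * z) - b * (1 - s * z)) / 2)) * (- 2 * s ^ 2 * z)
        = (s * of_nat n) * \<i> * ((a + b) * (1 - s ^ 2 * z ^ 2) + (a * (1 + s * z) - b * (1 - s * z)) * (s * z))"
      by (simp add: field_simps power2_eq_square)
    also have "\<dots> = of_nat 2 * ((a * (1 + s * z) + b * (1 - s * z)) / 2) ^ (2 - 1)"
      unfolding s by (simp add: algebra_simps power2_eq_square)
    finally show "of_nat 2 * (\<i> * (s * of_nat n * ((1 + s * z) ^ (m + 1) + (1 - s * z) ^ (m + 1)) / 2)) * (1 - s ^ 2 * z ^ 2)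
          - of_nat n * (\<i> * (((1 + s * z) ^ n - (1 - s * z) ^ n) / 2)) * (- 2 * s ^ 2 * z)
        = of_nat 2 * (((1 + s * z) ^ n + (1 - s * z) ^ n) / 2) ^ (2 - 1)"
      unfolding ab a_def b_def .
    \<comment> \<open>As k0 = k1 = 2, the Hessian relation only says that the quadratic form Pinf
      has the right constant Hessian.\<close>
    have "of_nat n ^ 2 * s ^ 2 = (-1 :: complex)" using s(1) by (simp add: power_mult_distrib [symmetric] mult.commute)
    then have "of_nat n ^ 2 * (2 * (1 - s ^ 2 * z ^ 2) * (- 2 * s ^ 2) - (2 - 1) * (- 2 * s ^ 2 * z) ^ 2) = 4"
      by algebra
    then show "of_nat n ^ 2 * (of_nat (2 * n div n) * (1 - s ^ 2 * z ^ 2) * (- 2 * s ^ 2)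
          - (of_nat (2 * n div n) - 1) * (- 2 * s ^ 2 * z) ^ 2)
        = (of_nat (2 * n div n) - 1) * of_nat 2 ^ 2 * (\<i> * (((1 + s * z) ^ n - (1 - s * z) ^ n) / 2)) ^ (2 - 2)
          * (((1 + s * z) ^ n + (1 - s * z) ^ n) / 2) ^ (2 - 2)"
      unfolding N by simp
  qed (use n in simp_all)
  moreover have "explicit_forms (2, 2, n) (P0, P1, Pinf)"
    using D_forms_2 unfolding P[symmetric] by (auto simp: explicit_forms_def)
  ultimately show ?thesis unfolding realized_def by blast
qed

text \<open>The identity behind D1 with P1 and Pinf exchanged: now P1^n = p q, with the real s = 1/n
  and no factor i.\<close>

lemma realized_D2:
  assumes n: "n \<ge> 2"
  shows "realized 2 n 2 (2 * n)"
proof -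
  obtain m where m: "n = m + 2" using n nat_le_iff_add by (metis add.commute)
  define s where "s = 1 / (of_nat n :: complex)"
  obtain P0 P1 Pinf where P: "D2_forms n = (P0, P1, Pinf)" by (cases "D2_forms n")
  have nz: "of_nat n \<noteq> (0::complex)" and N: "2 * n div 2 = n" "2 * n div n = 2" using n by auto
  have s: "s * of_nat n = 1" "1 / of_nat n ^ 2 = s ^ 2" using nz by (simp_all add: s_def field_simps power2_eq_square)
  have e: "eval2 P0 1 = (\<lambda>z. ((1 + s * z) ^ n - (1 - s * z) ^ n) / 2)"
    "eval2 P1 1 = (\<lambda>z. 1 - s ^ 2 * z ^ 2)"
    "eval2 Pinf 1 = (\<lambda>z. ((1 + s * z) ^ n + (1 - s * z) ^ n) / 2)"
    using P s(2) unfolding D2_forms_def s_def[symmetric] prod.inject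
    by (auto simp only: fun_eq_iff eval2_even_odd eval2_simps s(2)) simp_all
  have "klein_forms 2 n 2 (2 * n) P0 P1 Pinf
    (\<lambda>z. ((1 + s * z) ^ (m + 1) - (1 - s * z) ^ (m + 1)) / 2)
    (\<lambda>z. s * of_nat (m + 1) * ((1 + s * z) ^ m + (1 - s * z) ^ m) / 2)
    (\<lambda>z. ((1 + s * z) ^ (m + 1) + (1 - s * z) ^ (m + 1)) / 2) (\<lambda>z. - 2 * s ^ 2 * z)"
  proof (unfold_locales, unfold e)
    show "2 / real (2 * n) = 1 / real 2 + 1 / real n + 1 / real 2 - 1" by simp
    show "form_of_degree (2 * n div 2) P0" "form_of_degree (2 * n div n) P1" "form_of_degree (2 * n div 2) Pinf"
      using P unfolding D2_forms_def N
      by (auto simp only: prod.inject intro!: form_of_degree_cscale form_of_degree_even_odd form_of_degree_quadratic)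
    fix z
    have nm: "n - Suc 0 = m + 1" using m by simp
    \<comment> \<open>The exponent is n - 2 because the Hessian relation must produce h^(n - 2) = a
      b.\<close>
    define a b where "a = (1 + s * z) ^ m" and "b = (1 - s * z) ^ m"
    have ab: "(1 + s * z) ^ n = a * (1 + s * z) ^ 2" "(1 - s * z) ^ n = b * (1 - s * z) ^ 2"
      "(1 + s * z) ^ (m + 1) = a * (1 + s * z)" "(1 - s * z) ^ (m + 1) = b * (1 - s * z)"
      by (simp_all add: a_def b_def m power_add power2_eq_square mult_ac)
    have q: "(1 - s ^ 2 * z ^ 2) ^ k = (1 + s * z) ^ k * (1 - s * z) ^ k" for k
      by (simp add: power_mult_distrib [symmetric] algebra_simps power2_eq_square)
    have sm: "s * of_nat (m + 1) = 1 - s" using s(1) by (simp add: m algebra_simps)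
    show "((\<lambda>z. 1 - s ^ 2 * z ^ 2) has_field_derivative - 2 * s ^ 2 * z) (at z)"
      by (auto intro!: derivative_eq_intros)
    have d: "((\<lambda>z. (1 + s * z) ^ n) has_field_derivative (1 + s * z) ^ (m + 1)) (at z)"
      "((\<lambda>z. (1 - s * z) ^ n) has_field_derivative - ((1 - s * z) ^ (m + 1))) (at z)"
    proof -
      have "((\<lambda>z. (1 + s * z) ^ n) has_field_derivative (s * of_nat n) * (1 + s * z) ^ (m + 1)) (at z)"
        "((\<lambda>z. (1 - s * z) ^ n) has_field_derivative - ((s * of_nat n) * (1 - s * z) ^ (m + 1))) (at z)"
        by ((rule derivative_eq_intros refl)+, simp add: nm)+
      then show "((\<lambda>z. (1 + s * z) ^ n) has_field_derivative (1 + s * z) ^ (m + 1)) (at z)"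
        "((\<lambda>z. (1 - s * z) ^ n) has_field_derivative - ((1 - s * z) ^ (m + 1))) (at z)"
        unfolding s by simp_all
    qed
    show "((\<lambda>z. ((1 + s * z) ^ n + (1 - s * z) ^ n) / 2) has_field_derivative
        ((1 + s * z) ^ (m + 1) - (1 - s * z) ^ (m + 1)) / 2) (at z)"
      "((\<lambda>z. ((1 + s * z) ^ n - (1 - s * z) ^ n) / 2) has_field_derivative
        ((1 + s * z) ^ (m + 1) + (1 - s * z) ^ (m + 1)) / 2) (at z)"
      by (rule derivative_eq_intros d refl | simp)+
    show "((\<lambda>z. ((1 + s * z) ^ (m + 1) - (1 - s * z) ^ (m + 1)) / 2) has_field_derivative
        s * of_nat (m + 1) * ((1 + s * z) ^ m + (1 - s * z) ^ m) / 2) (at z)"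
      by (rule derivative_eq_intros refl | simp)+ (simp add: algebra_simps)
    show "(((1 + s * z) ^ n - (1 - s * z) ^ n) / 2) ^ 2 + (1 - s ^ 2 * z ^ 2) ^ n
        = (((1 + s * z) ^ n + (1 - s * z) ^ n) / 2) ^ 2"
      unfolding q by (simp add: power_divide field_simps power2_eq_square)
    have n1: "n - 1 = m + 1" "n - 2 = m" using m by simp_all
    show "of_nat 2 * (((1 + s * z) ^ (m + 1) + (1 - s * z) ^ (m + 1)) / 2) * (((1 + s * z) ^ n + (1 - s * z) ^ n) / 2)
          - of_nat 2 * (((1 + s * z) ^ n - (1 - s * z) ^ n) / 2) * (((1 + s * z) ^ (m + 1) - (1 - s * z) ^ (m + 1)) / 2)
        = of_nat 2 * (1 - s ^ 2 * z ^ 2) ^ (n - 1)"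
      unfolding n1 q ab by (simp add: field_simps power2_eq_square)
    have "of_nat 2 ^ 2 * (of_nat n * ((a * (1 + s * z) ^ 2 + b * (1 - s * z) ^ 2) / 2) * ((1 - s) * (a + b) / 2)
          - (of_nat n - 1) * ((a * (1 + s * z) - b * (1 - s * z)) / 2) ^ 2)
        = (of_nat n - s * of_nat n) * ((a * (1 + s * z) ^ 2 + b * (1 - s * z) ^ 2) * (a + b))
          - (of_nat n - 1) * (a * (1 + s * z) - b * (1 - s * z)) ^ 2"
      by (simp add: power_divide field_simps)
    also have "\<dots> = (of_nat n - 1) * of_nat 2 ^ 2 * (a * b)"
      unfolding s by (simp add: algebra_simps power2_eq_square)
    finally show "of_nat 2 ^ 2 * (of_nat (2 * n div 2) * (((1 + s * z) ^ n + (1 - s * z) ^ n) / 2)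
            * (s * of_nat (m + 1) * ((1 + s * z) ^ m + (1 - s * z) ^ m) / 2)
          - (of_nat (2 * n div 2) - 1) * (((1 + s * z) ^ (m + 1) - (1 - s * z) ^ (m + 1)) / 2) ^ 2)
        = (of_nat (2 * n div 2) - 1) * of_nat 2 ^ 2 * (((1 + s * z) ^ n - (1 - s * z) ^ n) / 2) ^ (2 - 2)
          * (1 - s ^ 2 * z ^ 2) ^ (n - 2)"
      unfolding n1 q sm ab by (simp add: a_def b_def)
  qed (use n in simp_all)
  moreover have "explicit_forms (2, n, 2) (P0, P1, Pinf)"
    using D_forms_2 unfolding P[symmetric] by (auto simp: explicit_forms_def)
  ultimately show ?thesis unfolding realized_def by blast
qed

lemma polyhedral_realized:
  "polyhedral k0 k1 kinf N \<Longrightarrow> realized k0 k1 kinf N"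
  by (induction rule: polyhedral.induct)
    (intro realized_D1 realized_D2 realized_D3 realized_T1 realized_T2 realized_T3 realized_O1 realized_O2
      realized_O3 realized_O4 realized_O5 realized_O6 realized_I1 realized_I2 realized_I3 realized_I4
      realized_I5 realized_I6; assumption)+

theorem theorem2p1:
  fixes k0 k1 kinf N :: nat
  assumes "polyhedral k0 k1 kinf N"
  shows "\<exists>P0 P1 Pinf :: complex poly poly.
    homogeneous (N div k0) P0 \<and> homogeneous (N div k1) P1 \<and> homogeneous (N div kinf) Pinf \<and>
    explicit_forms (k0, k1, kinf) (P0, P1, Pinf) \<and>
    (\<forall>a b c :: real.
       \<bar>1 - c\<bar> = 1 / real k0 \<and> \<bar>c - a - b\<bar> = 1 / real k1 \<and> \<bar>a - b\<bar> = 1 / real kinf \<longrightarrow>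
       (\<exists>!s. sign_pattern s (1 - c) (c - a - b) (a - b) \<or>
             sign_pattern s (1 - c) (c - b - a) (b - a)) \<and>
       (\<forall>s. sign_pattern s (1 - c) (c - a - b) (a - b) \<longrightarrow>
          (\<forall>x l0 :: complex. 0 < norm x \<and> norm x < 1 \<and> exp l0 = x \<longrightarrow>
             identities s (k0, k1, kinf) N (P0, P1, Pinf) l0 (Ln (1 - x))
               (kummer_u a b c x) (kummer_v a b c l0 x)) \<and>
          (\<forall>\<Omega> x l0 l1 u v. kummer_continuation a b c \<Omega> x l0 l1 u v \<longrightarrow>
             (\<forall>t\<in>\<Omega>. identities s (k0, k1, kinf) N (P0, P1, Pinf) (l0 t) (l1 t) (u t) (v t)))))"
proof -
  obtain P0 P1 Pinf f1 f2 g1 h1 where "klein_forms k0 k1 kinf N P0 P1 Pinf f1 f2 g1 h1"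
    and explicit: "explicit_forms (k0, k1, kinf) (P0, P1, Pinf)"
    using polyhedral_realized[OF assms] unfolding realized_def by blast
  then interpret klein_forms k0 k1 kinf N P0 P1 Pinf f1 f2 g1 h1 by simp
  from explicit show ?thesis by (rule klein_theorem)
qed

end
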